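(* Let $\alpha\in\mathbb{R}$ and $t>0$. The condition $$\int_0^t\int_{|x|>1}e^{-\alpha x}\,K_s(dx)\,ds<\infty \qquad (\mathrm{A}_\alpha)$$ is equivalent to ${\bf E}(e^{-\alpha X_t})<\infty$. For $\alpha\ge 1$ and for $\alpha\le 0$, condition $(\mathrm{A}_\alpha)$ implies ${\bf E}(I_t^{\alpha})<\infty$. In addition, if $(\mathrm{A}_1)$ holds (i.e. the condition above is valid with $\alpha=1$), then ${\bf E}(I_t^{\alpha})<\infty$ for every $0\le\alpha\le 1$.
   Context: $X=(X_t)_{t\ge 0}$ is a real-valued càdlàg process with independent increments, $X_0=0$, which is a semimartingale with respect to its natural filtration. Its (deterministic) semimartingale triplet $(B,C,\nu)$, relative to the truncation function $x{\bf 1}_{\{|x|\le 1\}}$, is absolutely continuous in time: $B_t=\int_0^t b_s\,ds$, $C_t=\int_0^t c_s\,ds$, $\nu(dt,dx)=dt\,K_t(dx)$, with measurable functions $b=(b_s)_{s\ge0}$, $c=(c_s)_{s\ge 0}$ ($c\ge 0$), and a kernel $K=(K_t(A))_{t\ge 0,\,A\in\mathcal{B}(\mathbb{R}\setminus\{0\})}$ satisfying $\int_0^t\int_{\mathbb{R}\setminus\{0\}}(x^2\wedge 1)K_s(dx)\,ds<\infty$ for each $t\ge 0$. Thus for $\lambda\in\mathbb{R}$, $${\bf E}e^{i\lambda X_t}=\exp\Big\{i\lambda B_t-\tfrac12\lambda^2C_t+\int_0^t\int_{\mathbb{R}\setminus\{0\}}(e^{i\lambda x}-1-i\lambda x{\bf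 1}_{\{|x|\le 1\}})K_s(dx)\,ds\Big\}.$$ The exponential functional is $I_t=\int_0^t e^{-X_s}\,ds$. *)

theory Defs
  imports "HOL-Probability.Probability"
begin

text \<open>A process is a function \<open>X :: real \<Rightarrow> 'a \<Rightarrow> real\<close>; only the times \<open>t \<ge> 0\<close> are meaningful, and
  no definition below depends on its values at negative times. Likewise a filtration is a family
  \<open>F :: real \<Rightarrow> 'a measure\<close> of which only the sigma-algebras matter.\<close>

subsection \<open>Paths\<close>

definition cadlag :: "(real \<Rightarrow> real) \<Rightarrow> bool" where
  "cadlag f \<longleftrightarrow>
     (\<forall>t\<ge>0. (f \<longlongrightarrow> f t) (at_right t)) \<and> (\<forall>t>0. \<exists>l. (f \<longlongrightarrow> l) (at_left t))"

definition jump :: "(real \<Rightarrow> real) \<Rightarrow> real \<Rightarrow> real" where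
  "jump f t = f t - Lim (at_left t) f"

definition locally_finite_variation :: "(real \<Rightarrow> real) \<Rightarrow> bool" where
  "locally_finite_variation f \<longleftrightarrow>
     (\<forall>t\<ge>0. \<exists>V. \<forall>n \<tau>. mono_on {..n} \<tau> \<and> \<tau> ` {..n} \<subseteq> {0..t} \<longrightarrow>
        (\<Sum>i<n. \<bar>f (\<tau> (Suc i)) - f (\<tau> i)\<bar>) \<le> V)"

subsection \<open>Independent increments and the natural filtration\<close>

definition independent_increments :: "'a measure \<Rightarrow> (real \<Rightarrow> 'a \<Rightarrow> real) \<Rightarrow> bool" where
  "independent_increments M X \<longleftrightarrow>
     (\<forall>n (\<tau> :: nat \<Rightarrow> real). 0 \<le> \<tau> 0 \<and> strict_mono_on {..n} \<tau> \<longrightarrow>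
        prob_space.indep_vars M (\<lambda>_. borel) (\<lambda>i \<omega>. X (\<tau> (Suc i)) \<omega> - X (\<tau> i) \<omega>) {..<n})"

definition past_events :: "'a measure \<Rightarrow> (real \<Rightarrow> 'a \<Rightarrow> real) \<Rightarrow> real \<Rightarrow> 'a set set" where
  "past_events M X t = {X s -` A \<inter> space M | s A. 0 \<le> s \<and> s \<le> t \<and> A \<in> sets borel}"

text \<open>The natural filtration satisfies the usual conditions: it is made right-continuous and
  enlarged by the null sets of \<open>M\<close> (which need not be complete).\<close>

definition natural_filtration :: "'a measure \<Rightarrow> (real \<Rightarrow> 'a \<Rightarrow> real) \<Rightarrow> real \<Rightarrow> 'a measure" where
  "natural_filtration M X t =
     sigma (space M) (\<Inter>u\<in>{t<..}. sigma_sets (space M) (past_events M X u \<union> null_sets M))"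

subsection \<open>Semimartingales\<close>

definition adapted :: "(real \<Rightarrow> 'a measure) \<Rightarrow> (real \<Rightarrow> 'a \<Rightarrow> real) \<Rightarrow> bool" where
  "adapted F N \<longleftrightarrow> (\<forall>t\<ge>0. N t \<in> borel_measurable (F t))"

definition martingale ::
  "'a measure \<Rightarrow> (real \<Rightarrow> 'a measure) \<Rightarrow> (real \<Rightarrow> 'a \<Rightarrow> real) \<Rightarrow> bool" where
  "martingale M F N \<longleftrightarrow>
     adapted F N \<and> (\<forall>t\<ge>0. integrable M (N t)) \<and>
     (\<forall>s t. 0 \<le> s \<and> s \<le> t \<longrightarrow> (AE \<omega> in M. real_cond_exp M (F s) (N t) \<omega> = N s \<omega>))"

text \<open>The localizing stopping times may be taken finite, replacing \<open>T n\<close> by \<open>min (T n) n\<close>; for the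
  same reason it is irrelevant whether uniform integrability of the stopped martingales is
  required.\<close>

definition local_martingale ::
  "'a measure \<Rightarrow> (real \<Rightarrow> 'a measure) \<Rightarrow> (real \<Rightarrow> 'a \<Rightarrow> real) \<Rightarrow> bool" where
  "local_martingale M F N \<longleftrightarrow>
     adapted F N \<and> (\<forall>\<omega>\<in>space M. cadlag (\<lambda>t. N t \<omega>)) \<and>
     (\<exists>T :: nat \<Rightarrow> 'a \<Rightarrow> real.
        (\<forall>n. stopping_time F (T n)) \<and>
        (\<forall>\<omega>\<in>space M. incseq (\<lambda>n. T n \<omega>) \<and> (\<forall>n. 0 \<le> T n \<omega>)) \<and>
        (AE \<omega> in M. filterlim (\<lambda>n. T n \<omega>) at_top sequentially) \<and>
        (\<forall>n. martingale M F (\<lambda>t \<omega>. N (min t (T n \<omega>)) \<omega>)))"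

definition finite_variation_process ::
  "'a measure \<Rightarrow> (real \<Rightarrow> 'a measure) \<Rightarrow> (real \<Rightarrow> 'a \<Rightarrow> real) \<Rightarrow> bool" where
  "finite_variation_process M F A \<longleftrightarrow>
     adapted F A \<and>
     (\<forall>\<omega>\<in>space M. A 0 \<omega> = 0 \<and> cadlag (\<lambda>t. A t \<omega>) \<and> locally_finite_variation (\<lambda>t. A t \<omega>))"

definition semimartingale ::
  "'a measure \<Rightarrow> (real \<Rightarrow> 'a measure) \<Rightarrow> (real \<Rightarrow> 'a \<Rightarrow> real) \<Rightarrow> bool" where
  "semimartingale M F X \<longleftrightarrow>
     adapted F X \<and> (\<forall>\<omega>\<in>space M. cadlag (\<lambda>t. X t \<omega>)) \<and>
     (\<exists>N A. local_martingale M F N \<and> (\<forall>\<omega>\<in>space M. N 0 \<omega> = 0) \<and>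
        finite_variation_process M F A \<and>
        (AE \<omega> in M. \<forall>t\<ge>0. X t \<omega> = X 0 \<omega> + N t \<omega> + A t \<omega>))"

subsection \<open>The triplet of a semimartingale\<close>

definition continuous_local_martingale ::
  "'a measure \<Rightarrow> (real \<Rightarrow> 'a measure) \<Rightarrow> (real \<Rightarrow> 'a \<Rightarrow> real) \<Rightarrow> bool" where
  "continuous_local_martingale M F N \<longleftrightarrow>
     local_martingale M F N \<and> (\<forall>\<omega>\<in>space M. continuous_on {0..} (\<lambda>t. N t \<omega>))"

definition purely_discontinuous ::
  "'a measure \<Rightarrow> (real \<Rightarrow> 'a measure) \<Rightarrow> (real \<Rightarrow> 'a \<Rightarrow> real) \<Rightarrow> bool" where
  "purely_discontinuous M F Y \<longleftrightarrow>
     local_martingale M F Y \<and> (\<forall>\<omega>\<in>space M. Y 0 \<omega> = 0) \<and>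
     (\<forall>N. continuous_local_martingale M F N \<longrightarrow> local_martingale M F (\<lambda>t \<omega>. Y t \<omega> * N t \<omega>))"

definition continuous_martingale_part ::
  "'a measure \<Rightarrow> (real \<Rightarrow> 'a measure) \<Rightarrow> (real \<Rightarrow> 'a \<Rightarrow> real) \<Rightarrow> (real \<Rightarrow> 'a \<Rightarrow> real) \<Rightarrow> bool" where
  "continuous_martingale_part M F X Xc \<longleftrightarrow>
     continuous_local_martingale M F Xc \<and> (\<forall>\<omega>\<in>space M. Xc 0 \<omega> = 0) \<and>
     (\<exists>Y A. purely_discontinuous M F Y \<and> finite_variation_process M F A \<and>
        (AE \<omega> in M. \<forall>t\<ge>0. X t \<omega> = X 0 \<omega> + Xc t \<omega> + Y t \<omega> + A t \<omega>))"

text \<open>The process \<open>X\<close> without its jumps \<open>\<Delta>X - h(\<Delta>X)\<close>, where \<open>h x = x 1_{|x| \<le> 1}\<close>. For a cadlag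
  path the sum is finite.\<close>

definition without_big_jumps :: "(real \<Rightarrow> 'a \<Rightarrow> real) \<Rightarrow> real \<Rightarrow> 'a \<Rightarrow> real" where
  "without_big_jumps X t \<omega> =
     X t \<omega> - (\<Sum>s\<in>{s\<in>{0<..t}. \<bar>jump (\<lambda>u. X u \<omega>) s\<bar> > 1}. jump (\<lambda>u. X u \<omega>) s)"

definition predictable_sigma :: "(real \<Rightarrow> 'a measure) \<Rightarrow> ('a \<times> real) measure" where
  "predictable_sigma F =
     sigma (space (F 0) \<times> {0..})
       ({A \<times> {0} | A. A \<in> sets (F 0)} \<union>
        {A \<times> {s<..t} | A s t. 0 \<le> s \<and> s \<le> t \<and> A \<in> sets (F s)})"

definition borel_nonzero :: "real measure" where
  "borel_nonzero = restrict_space borel (- {0})"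

definition levy_kernel :: "(real \<Rightarrow> real measure) \<Rightarrow> bool" where
  "levy_kernel K \<longleftrightarrow>
     (\<forall>s\<ge>0. sets (K s) = sets borel_nonzero) \<and>
     (\<forall>A\<in>sets borel_nonzero. (\<lambda>s. emeasure (K s) A) \<in> borel_measurable (restrict_space borel {0..}))"

text \<open>\<open>dt K_t(dx)\<close> is the compensator of the jump measure of \<open>X\<close>: both measures give the same
  expected integral to every nonnegative predictable function \<open>W(\<omega>, s, x)\<close>. The integral with
  respect to the jump measure is the sum of \<open>W(\<omega>, s, \<Delta>X_s)\<close> over the jump times.\<close>

definition jump_compensator ::
  "'a measure \<Rightarrow> (real \<Rightarrow> 'a measure) \<Rightarrow> (real \<Rightarrow> 'a \<Rightarrow> real) \<Rightarrow> (real \<Rightarrow> real measure) \<Rightarrow> bool" where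
  "jump_compensator M F X K \<longleftrightarrow>
     (\<forall>W :: ('a \<times> real) \<times> real \<Rightarrow> ennreal.
        W \<in> borel_measurable (predictable_sigma F \<Otimes>\<^sub>M borel_nonzero) \<longrightarrow>
        (\<integral>\<^sup>+\<omega>. (\<integral>\<^sup>+s. W ((\<omega>, s), jump (\<lambda>u. X u \<omega>) s)
             \<partial>count_space {s. 0 < s \<and> jump (\<lambda>u. X u \<omega>) s \<noteq> 0}) \<partial>M) =
        (\<integral>\<^sup>+\<omega>. (\<integral>\<^sup>+s\<in>{0..}. (\<integral>\<^sup>+x. W ((\<omega>, s), x) \<partial>K s) \<partial>lborel) \<partial>M))"

text \<open>\<open>(B, C, \<nu>)\<close> with \<open>\<nu>(dt,dx) = dt K_t(dx)\<close> is the deterministic triplet of \<open>X\<close> relative to the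
  truncation function \<open>x 1_{|x| \<le> 1}\<close>. A deterministic cadlag function is predictable, so the
  third line says that \<open>B\<close> is the predictable finite variation part in the canonical decomposition
  of \<open>without_big_jumps X\<close>; similarly \<open>C\<close> is the predictable quadratic variation of the
  continuous martingale part.\<close>

definition deterministic_triplet ::
  "'a measure \<Rightarrow> (real \<Rightarrow> 'a measure) \<Rightarrow> (real \<Rightarrow> 'a \<Rightarrow> real) \<Rightarrow>
   (real \<Rightarrow> real) \<Rightarrow> (real \<Rightarrow> real) \<Rightarrow> (real \<Rightarrow> real measure) \<Rightarrow> bool" where
  "deterministic_triplet M F X B C K \<longleftrightarrow>
     B 0 = 0 \<and> cadlag B \<and> locally_finite_variation B \<and>
     C 0 = 0 \<and> continuous_on {0..} C \<and> mono_on {0..} C \<and>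
     local_martingale M F (\<lambda>t \<omega>. without_big_jumps X t \<omega> - X 0 \<omega> - B t) \<and>
     (\<exists>Xc. continuous_martingale_part M F X Xc \<and>
        local_martingale M F (\<lambda>t \<omega>. (Xc t \<omega>)\<^sup>2 - C t)) \<and>
     jump_compensator M F X K"

subsection \<open>The exponential functional and the moment condition\<close>

definition exp_functional :: "(real \<Rightarrow> 'a \<Rightarrow> real) \<Rightarrow> real \<Rightarrow> 'a \<Rightarrow> real" where
  "exp_functional X t \<omega> = (LBINT s:{0..t}. exp (- X s \<omega>))"

definition condition_A :: "(real \<Rightarrow> real measure) \<Rightarrow> real \<Rightarrow> real \<Rightarrow> bool" where
  "condition_A K t \<alpha> \<longleftrightarrow>
     (\<integral>\<^sup>+s\<in>{0..t}. (\<integral>\<^sup>+x\<in>{x. \<bar>x\<bar> > 1}. ennreal (exp (- \<alpha> * x)) \<partial>K s) \<partial>lborel) < \<infinity>"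

end

theory Submission
  imports Defs
begin

text \<open>
  For fixed \<open>t\<close> the law of \<open>X t\<close> is infinitely divisible with Levy measure
  \<open>\<mu>(A) = \<integral>\<^sub>0\<^sup>t K s A ds\<close>, and condition \<open>(A\<^sub>\<alpha>)\<close> says that \<open>exp (- \<alpha> x)\<close> is \<open>\<mu>\<close>-integrable over
  \<open>{\<bar>x\<bar> > 1}\<close>. This law is the weak limit of the laws of \<open>W n + Z\<close>, where \<open>Z\<close> is an independent
  compound Poisson variable carrying the jumps larger than 1 and \<open>W n\<close> is a Gaussian plus the
  compensated jumps of size in \<open>(1/(n+1), 1]\<close>. All exponential moments of \<open>W n\<close> are bounded in
  \<open>n\<close>, so everything depends on \<open>Z\<close>: testing the weak convergence on \<open>min (exp (a x)) r\<close> and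
  letting \<open>r\<close> grow, one bounds the moment of \<open>X t\<close> above by the moment of \<open>Z\<close>, and, \<open>W n\<close> being
  tight and \<open>Z\<close> having exactly one jump with positive probability, below by the integral
  against \<open>\<mu>\<close>.

  For the functional \<open>I\<close>, convexity of \<open>x powr \<alpha>\<close> gives
  \<open>I powr \<alpha> \<le> t powr (\<alpha> - 1) * \<integral>\<^sub>0\<^sup>t exp (- \<alpha> X s) ds\<close>, so it suffices to bound
  \<open>E exp (- \<alpha> X s)\<close> over \<open>s \<le> t\<close>. As \<open>E exp (- \<alpha> X t)\<close> is the product of this number and
  \<open>E exp (- \<alpha> (X t - X s))\<close>, a lower bound for the latter is enough, and it follows from the
  boundedness of cadlag paths on \<open>[0, t]\<close>.
\<close>

subsection \<open>Convolution powers and compound Poisson laws\<close>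

lemma real_distributionI:
  assumes "prob_space M" "sets M = sets borel"
  shows "real_distribution M"
  using assms by (simp add: real_distribution_def real_distribution_axioms_def)

lemma real_distribution_return: "real_distribution (return borel a)"
  by (intro real_distributionI prob_space_return) auto

lemma char_return: "char (return borel a) z = iexp (z * a)"
  by (simp add: char_def integral_return)

lemma real_distribution_convolution:
  assumes "real_distribution M" "real_distribution N"
  shows "real_distribution (M \<star> N)"
proof -
  interpret M: real_distribution M by fact
  interpret N: real_distribution N by fact
  interpret P: pair_prob_space M N ..
  show ?thesis unfolding convolution_def
    by (rule P.real_distribution_distr) measurable
qed

lemma char_convolution:
  assumes "real_distribution M" "real_distribution N"
  shows "char (M \<star> N) z = char M z * char N z"
proof -
  interpret M: real_distribution M by fact
  interpret N: real_distribution N by fact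
  interpret P: pair_prob_space M N ..
  have int: "integrable (M \<Otimes>\<^sub>M N) (\<lambda>p. iexp (z * (fst p + snd p)))"
    by (rule P.integrable_iexp) auto
  have "char (M \<star> N) z = (CLINT p|M \<Otimes>\<^sub>M N. iexp (z * (fst p + snd p)))"
    unfolding char_def convolution_def
    by (subst integral_distr) (auto simp: case_prod_beta)
  also have "\<dots> = (CLINT x|M. CLINT y|N. iexp (z * x) * iexp (z * y))"
    using int by (subst P.integral_fst'[symmetric])
      (auto simp: exp_add[symmetric] algebra_simps)
  also have "\<dots> = char M z * char N z"
    by (simp add: char_def)
  finally show ?thesis .
qed

lemma nn_integral_exp_convolution:
  assumes "real_distribution M" "real_distribution N"
  shows "(\<integral>\<^sup>+x. ennreal (exp (a * x)) \<partial>(M \<star> N)) =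
    (\<integral>\<^sup>+x. ennreal (exp (a * x)) \<partial>M) * (\<integral>\<^sup>+x. ennreal (exp (a * x)) \<partial>N)"
proof -
  interpret M: real_distribution M by fact
  interpret N: real_distribution N by fact
  show ?thesis
    by (subst nn_integral_convolution)
       (auto simp: distrib_left exp_add ennreal_mult nn_integral_cmult nn_integral_multc
          M.finite_measure_axioms N.finite_measure_axioms)
qed

primrec convolution_power :: "real measure \<Rightarrow> nat \<Rightarrow> real measure" where
  "convolution_power \<sigma> 0 = return borel 0"
| "convolution_power \<sigma> (Suc n) = (\<sigma> \<star> convolution_power \<sigma> n)"

context
  fixes \<sigma> :: "real measure"
  assumes \<sigma>: "real_distribution \<sigma>"
begin

lemma real_distribution_convolution_power: "real_distribution (convolution_power \<sigma> n)"
  by (induction n) (auto intro: real_distribution_return real_distribution_convolution \<sigma>)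

lemma char_convolution_power: "char (convolution_power \<sigma> n) z = char \<sigma> z ^ n"
  by (induction n)
     (auto simp: char_return char_convolution \<sigma> real_distribution_convolution_power)

lemma nn_integral_exp_convolution_power:
  "(\<integral>\<^sup>+x. ennreal (exp (a * x)) \<partial>convolution_power \<sigma> n) = (\<integral>\<^sup>+x. ennreal (exp (a * x)) \<partial>\<sigma>) ^ n"
  by (induction n)
     (auto simp: nn_integral_return nn_integral_exp_convolution \<sigma> real_distribution_convolution_power)

text \<open>The power 1 unfolds to \<open>\<sigma>\<close> convolved with the unit mass at 0, which
  is not literally \<open>\<sigma>\<close>. The identification of integrals is what isolates the
  one-jump term of a compound Poisson law.\<close>

lemma nn_integral_convolution_power_1:
  assumes [measurable]: "f \<in> borel_measurable borel"
  shows "(\<integral>\<^sup>+x. f x \<partial>convolution_power \<sigma> 1) = (\<integral>\<^sup>+x. f x \<partial>\<sigma>)"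
proof -
  interpret real_distribution \<sigma> by (rule \<sigma>)
  interpret r: real_distribution "return borel (0::real)" by (rule real_distribution_return)
  show ?thesis
    by (simp add: nn_integral_convolution nn_integral_return
        finite_measure_axioms r.finite_measure_axioms)
qed

end

text \<open>\<open>Z\<close> is the law of a sum of N independent jumps with law \<mu>/m, where m is
  the total mass of \<mu> and N is Poisson with parameter m. Its characteristic function and its
  exponential moments are both sums of an exponential series. The last property keeps only the event
  N = 1: its weight m exp(-m) cancels the normalization 1/m.\<close>

lemma compound_poisson_exists:
  assumes fin: "finite_measure \<mu>" and sets_\<mu>: "sets \<mu> = sets borel"
  obtains Z :: "real measure" where "real_distribution Z"
    "\<And>z. char Z z = exp (CLINT x|\<mu>. iexp (z * x) - 1)"
    "\<And>a. integrable \<mu> (\<lambda>x. exp (a * x)) \<Longrightarrow>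
      (\<integral>\<^sup>+x. ennreal (exp (a * x)) \<partial>Z) = ennreal (exp (LINT x|\<mu>. exp (a * x) - 1))"
    "\<And>f :: real \<Rightarrow> ennreal. f \<in> borel_measurable borel \<Longrightarrow>
      ennreal (exp (- measure \<mu> UNIV)) * (\<integral>\<^sup>+x. f x \<partial>\<mu>) \<le> (\<integral>\<^sup>+x. f x \<partial>Z)"
proof (cases "measure \<mu> UNIV = 0")
  \<comment> \<open>A null measure cannot be normalized to a jump law. There are no jumps then, and
    the unit mass at 0 is the required law.\<close>
  case True
  have sp: "space \<mu> = UNIV" using sets_\<mu> sets_eq_imp_space_eq by force
  interpret finite_measure \<mu> by fact
  have "emeasure \<mu> (space \<mu>) = 0"
    using True sp by (simp add: emeasure_eq_measure)
  then have null: "AE x in \<mu>. False"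
    by (intro AE_I[of _ _ "space \<mu>"]) auto
  have z: "(CLINT x|\<mu>. f x) = 0" "(LINT x|\<mu>. g x) = 0" for f g
    using null by (auto intro!: integral_eq_zero_AE)
  have z': "(\<integral>\<^sup>+x. h x \<partial>\<mu>) = 0" for h
  proof -
    have "(\<integral>\<^sup>+x. h x \<partial>\<mu>) = (\<integral>\<^sup>+x. 0 \<partial>\<mu>)"
      using null by (intro nn_integral_cong_AE) auto
    then show ?thesis by simp
  qed
  show ?thesis
    by (rule that[of "return borel 0"])
       (auto simp: z z' real_distribution_return char_return nn_integral_return)
next
  case False
  define m where "m = measure \<mu> UNIV"
  have m: "m > 0" using False by (simp add: m_def zero_less_measure_iff)
  have sp: "space \<mu> = UNIV" using sets_\<mu> sets_eq_imp_space_eq by force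
  interpret finite_measure \<mu> by fact
  note sets_\<mu>[measurable_cong]
  define \<sigma> where "\<sigma> = density \<mu> (\<lambda>_. ennreal (1 / m))"
  have [measurable_cong]: "sets \<sigma> = sets borel" by (simp add: \<sigma>_def sets_\<mu>)
  have "prob_space \<sigma>"
  proof
    have "emeasure \<sigma> (space \<sigma>) = ennreal (1 / m) * emeasure \<mu> UNIV"
      unfolding \<sigma>_def using sp sets_\<mu> by (subst emeasure_density) (auto simp: nn_integral_cmult)
    also have "\<dots> = 1"
      using m by (simp add: emeasure_eq_measure m_def[symmetric] ennreal_mult[symmetric])
    finally show "emeasure \<sigma> (space \<sigma>) = 1" .
  qed
  then have \<sigma>: "real_distribution \<sigma>"
    by (intro real_distributionI) (auto simp: \<sigma>_def sets_\<mu>)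
  let ?P = "convolution_power \<sigma>" and ?N = "measure_pmf (poisson_pmf m)"
  note P = real_distribution_convolution_power[OF \<sigma>]
  have P_meas: "?P \<in> measurable ?N (subprob_algebra borel)"
    using P by (auto simp: space_subprob_algebra real_distribution_def real_distribution_axioms_def
        intro: prob_space_imp_subprob_space)
  define Z where "Z = ?N \<bind> ?P"
  have setsZ [measurable_cong]: "sets Z = sets borel"
    unfolding Z_def by (rule sets_bind_measurable[OF P_meas]) auto
  have "prob_space Z"
    unfolding Z_def using P
    by (intro measure_pmf.prob_space_bind[OF _ P_meas]) (auto simp: real_distribution_def)
  then have Z: "real_distribution Z"
    using setsZ by (rule real_distributionI)
  interpret Z: real_distribution Z by (rule Z)
  interpret P: real_distribution "?P n" for n by (rule P)
  have nnZ: "(\<integral>\<^sup>+x. f x \<partial>Z) = (\<Sum>n. ennreal (m ^ n / fact n * exp (- m)) * (\<integral>\<^sup>+x. f x \<partial>?P n))"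
    if [measurable]: "f \<in> borel_measurable borel" for f
    unfolding Z_def using m
    by (subst nn_integral_bind[OF _ P_meas])
       (auto simp: nn_integral_measure_pmf nn_integral_count_space_nat)
  have intZ: "integral\<^sup>L Z f = (LINT n|?N. integral\<^sup>L (?P n) f)"
    if [measurable]: "f \<in> borel_measurable borel" and "\<And>x. \<bar>f x\<bar> \<le> 1" for f :: "real \<Rightarrow> real"
    unfolding Z_def
    by (rule integral_bind[where K=borel and B=1 and B'=1])
       (use that P_meas P.emeasure_space_1 in \<open>auto intro!: measure_pmf.finite_measure\<close>)
  show ?thesis
  proof (rule that[of Z])
    show "real_distribution Z" by (rule Z)
  next
    fix z
    have c\<sigma>: "of_real m * char \<sigma> z = (CLINT x|\<mu>. iexp (z * x))"
      unfolding char_def \<sigma>_def using m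
      by (subst integral_density) (auto simp: scaleR_conv_of_real)
    have int_it: "integrable \<mu> (\<lambda>x. iexp (z * x))"
      by (rule integrable_const_bound[where B=1]) auto
    have e: "(CLINT x|\<mu>. iexp (z * x) - 1) = of_real m * char \<sigma> z - of_real m"
      unfolding c\<sigma> using int_it by (simp add: m_def sp scaleR_conv_of_real)
    have int: "integrable ?N (\<lambda>n. char (?P n) z)"
      by (rule measure_pmf.integrable_const_bound[where B=1]) (auto simp: P.cmod_char_le_1)
    have iP: "integrable (?P n) (\<lambda>x. iexp (z * x))" for n
      by (rule P.integrable_const_bound[where B=1]) auto
    have iZ: "integrable Z (\<lambda>x. iexp (z * x))"
      by (rule Z.integrable_const_bound[where B=1]) auto
    \<comment> \<open>The exchange of the Poisson mixture with the integral is available in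
      \<open>intZ\<close> for bounded real functions only, so real and imaginary parts are treated
      separately.\<close>
    have "char Z z = (CLINT n|?N. char (?P n) z)"
    proof (rule complex_eqI)
      have "Re (char Z z) = (LINT x|Z. Re (iexp (z * x)))"
        unfolding char_def using iZ by (simp only: integral_Re)
      also have "\<dots> = (LINT n|?N. Re (char (?P n) z))"
        unfolding char_def using iP by (subst intZ) (auto simp: integral_Re[symmetric] Re_exp)
      also have "\<dots> = Re (CLINT n|?N. char (?P n) z)"
        using int by (rule integral_Re)
      finally show "Re (char Z z) = Re (CLINT n|?N. char (?P n) z)" .
      have "Im (char Z z) = (LINT x|Z. Im (iexp (z * x)))"
        unfolding char_def using iZ by (simp only: integral_Im)
      also have "\<dots> = (LINT n|?N. Im (char (?P n) z))"
        unfolding char_def using iP by (subst intZ) (auto simp: integral_Im[symmetric] Im_exp)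
      also have "\<dots> = Im (CLINT n|?N. char (?P n) z)"
        using int by (rule integral_Im)
      finally show "Im (char Z z) = Im (CLINT n|?N. char (?P n) z)" .
    qed
    also have "\<dots> = (CLINT n|count_space UNIV. (m ^ n / fact n * exp (- m)) *\<^sub>R char \<sigma> z ^ n)"
      using m by (simp add: measure_pmf_eq_density integral_density char_convolution_power[OF \<sigma>])
    also have "\<dots> = exp (of_real m * char \<sigma> z - of_real m)"
    proof -
      have "integrable (count_space UNIV) (\<lambda>n. (m ^ n / fact n * exp (- m)) *\<^sub>R char \<sigma> z ^ n)"
        using int m by (simp add: measure_pmf_eq_density integrable_density char_convolution_power[OF \<sigma>])
      then have "(\<lambda>n. (m ^ n / fact n * exp (- m)) *\<^sub>R char \<sigma> z ^ n) sums
          (CLINT n|count_space UNIV. (m ^ n / fact n * exp (- m)) *\<^sub>R char \<sigma> z ^ n)"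
        by (rule sums_integral_count_space_nat)
      \<comment> \<open>The Poisson weights turn the mixture of powers into exp(-m) times the
        exponential series at m times the characteristic function of one jump; uniqueness of sums
        then identifies the two values.\<close>
      moreover have "(\<lambda>n. exp (- of_real m) * ((of_real m * char \<sigma> z) ^ n /\<^sub>R fact n)) sums
          (exp (- of_real m) * exp (of_real m * char \<sigma> z))"
        by (intro sums_mult exp_converges)
      moreover have "(\<lambda>n. exp (- of_real m) * ((of_real m * char \<sigma> z) ^ n /\<^sub>R fact n)) =
          (\<lambda>n. (m ^ n / fact n * exp (- m)) *\<^sub>R char \<sigma> z ^ n)"
        by (auto simp: scaleR_conv_of_real field_simps power_mult_distrib exp_of_real[symmetric])
      ultimately show ?thesis
        by (simp add: sums_unique2 exp_diff exp_minus field_simps)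
    qed
    finally show "char Z z = exp (CLINT x|\<mu>. iexp (z * x) - 1)" using e by simp
  next
    fix a assume int: "integrable \<mu> (\<lambda>x. exp (a * x))"
    define L where "L = (LINT x|\<mu>. exp (a * x))"
    have L: "L \<ge> 0" unfolding L_def by simp
    have nn\<sigma>: "(\<integral>\<^sup>+x. ennreal (exp (a * x)) \<partial>\<sigma>) = ennreal (L / m)"
      unfolding \<sigma>_def using m L int
      by (subst nn_integral_density)
         (auto simp: nn_integral_cmult nn_integral_eq_integral L_def[symmetric] ennreal_mult[symmetric])
    have "ennreal (m ^ n / fact n * exp (- m)) * (\<integral>\<^sup>+x. ennreal (exp (a * x)) \<partial>?P n) =
        ennreal (exp (- m) * (L ^ n /\<^sub>R fact n))" for n
      unfolding nn_integral_exp_convolution_power[OF \<sigma>] nn\<sigma> using m L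
      by (simp add: ennreal_power ennreal_mult[symmetric] power_divide field_simps)
    then have "(\<integral>\<^sup>+x. ennreal (exp (a * x)) \<partial>Z) = (\<Sum>n. ennreal (exp (- m) * (L ^ n /\<^sub>R fact n)))"
      by (subst nnZ) auto
    also have "\<dots> = ennreal (exp (- m) * exp L)"
      using L by (intro suminf_ennreal_eq sums_mult exp_converges) auto
    also have "exp (- m) * exp L = exp (LINT x|\<mu>. exp (a * x) - 1)"
      using int by (simp add: L_def m_def sp exp_diff exp_minus field_simps)
    finally show "(\<integral>\<^sup>+x. ennreal (exp (a * x)) \<partial>Z) = ennreal (exp (LINT x|\<mu>. exp (a * x) - 1))" .
  next
    fix f :: "real \<Rightarrow> ennreal" assume [measurable]: "f \<in> borel_measurable borel"
    let ?g = "\<lambda>n. ennreal (m ^ n / fact n * exp (- m)) * (\<integral>\<^sup>+x. f x \<partial>?P n)"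
    \<comment> \<open>The term of index 1 has weight m exp(-m), and integrating against the first
      power contributes the factor 1/m.\<close>
    have "ennreal (exp (- measure \<mu> UNIV)) * (\<integral>\<^sup>+x. f x \<partial>\<mu>) = ?g 1"
      using m unfolding nn_integral_convolution_power_1[OF \<sigma> \<open>f \<in> _\<close>] unfolding \<sigma>_def
      by (subst nn_integral_density)
         (auto simp: nn_integral_cmult mult.assoc[symmetric] ennreal_mult[symmetric] m_def[symmetric])
    also have "\<dots> \<le> (\<Sum>n\<in>{1}. ?g n)" by simp
    also have "\<dots> \<le> (\<Sum>n. ?g n)" by (rule sum_le_suminf) auto
    also have "\<dots> = (\<integral>\<^sup>+x. f x \<partial>Z)" by (simp add: nnZ)
    finally show "ennreal (exp (- measure \<mu> UNIV)) * (\<integral>\<^sup>+x. f x \<partial>\<mu>) \<le> (\<integral>\<^sup>+x. f x \<partial>Z)" .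
  qed
qed

subsection \<open>Gaussian laws and the Levy-Khintchine integrand\<close>

text \<open>The parameter \<open>v\<close> is the variance. An affine image of the standard normal
  law, unlike a density, also covers \<open>v = 0\<close>, where it is the unit mass at
  \<open>b\<close>.\<close>

definition gaussian :: "real \<Rightarrow> real \<Rightarrow> real measure" where
  "gaussian b v = distr std_normal_distribution borel (\<lambda>x. b + sqrt v * x)"

lemma real_distribution_gaussian: "real_distribution (gaussian b v)"
proof -
  interpret real_distribution std_normal_distribution by (rule real_dist_normal_dist)
  show ?thesis unfolding gaussian_def by (rule real_distribution_distr) measurable
qed

lemma char_gaussian:
  assumes "v \<ge> 0"
  shows "char (gaussian b v) z = exp (\<i> * of_real (z * b) - of_real (z\<^sup>2 * v / 2))"
proof -
  have "char (gaussian b v) z =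
      (CLINT x|std_normal_distribution. iexp (z * b) * iexp (z * sqrt v * x))"
    unfolding char_def gaussian_def
    by (subst integral_distr) (auto simp: exp_add[symmetric] algebra_simps)
  also have "\<dots> = iexp (z * b) * char std_normal_distribution (z * sqrt v)"
    unfolding char_def by (rule integral_mult_right_zero)
  also have "char std_normal_distribution (z * sqrt v) = exp (of_real (- (z\<^sup>2 * v / 2)))"
    using assms unfolding char_std_normal_distribution
    by (simp add: power_mult_distrib exp_of_real[symmetric])
  also have "iexp (z * b) * exp (of_real (- (z\<^sup>2 * v / 2))) =
      exp (\<i> * of_real (z * b) - of_real (z\<^sup>2 * v / 2))"
    by (simp add: exp_add[symmetric])
  finally show ?thesis .
qed

lemma nn_integral_exp_gaussian:
  assumes "v \<ge> 0"
  shows "(\<integral>\<^sup>+x. ennreal (exp (a * x)) \<partial>gaussian b v) = ennreal (exp (a * b + a\<^sup>2 * v / 2))"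
proof -
  let ?c = "a * sqrt v"
  have c2: "?c\<^sup>2 = a\<^sup>2 * v" using assms by (simp add: power_mult_distrib)
  \<comment> \<open>Completing the square: the exponential tilt of the standard normal density is a
    multiple of a normal density with mean \<open>?c\<close> and variance 1.\<close>
  have eq: "std_normal_density x * exp (a * (b + sqrt v * x)) =
      exp (a * b + ?c\<^sup>2 / 2) * normal_density ?c 1 x" for x
    by (simp add: normal_density_def exp_add[symmetric] power2_eq_square field_simps)
  have one: "(\<integral>\<^sup>+x. ennreal (normal_density ?c 1 x) \<partial>lborel) = 1"
    using prob_space.emeasure_space_1[OF prob_space_normal_density[of 1 ?c]]
    by (simp add: emeasure_density)
  have "(\<integral>\<^sup>+x. ennreal (exp (a * x)) \<partial>gaussian b v) =
      (\<integral>\<^sup>+x. ennreal (std_normal_density x * exp (a * (b + sqrt v * x))) \<partial>lborel)"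
    unfolding gaussian_def
    by (simp add: nn_integral_distr nn_integral_density ennreal_mult)
  also have "\<dots> = ennreal (exp (a * b + ?c\<^sup>2 / 2)) * (\<integral>\<^sup>+x. ennreal (normal_density ?c 1 x) \<partial>lborel)"
    unfolding eq by (simp add: nn_integral_cmult ennreal_mult)
  finally show ?thesis by (simp add: one c2)
qed

section \<open>Pointwise bounds and truncation\<close>

text \<open>A second-order bound valid for both signs. It comes from 1 - u \<le> exp(-u), multiplied
  by exp u, which first bounds the left side by y (exp y - 1). It makes the exponents of the
  compensated small jumps bounded by a multiple of the integral of x^2.\<close>

lemma exp_minus_one_minus_le: "exp y - 1 - y \<le> y\<^sup>2 * exp \<bar>y\<bar>" for y :: real
proof -
  have *: "exp u - 1 \<le> u * exp u" for u :: real
  proof -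
    have "(1 - u) * exp u \<le> exp (- u) * exp u"
      using exp_ge_add_one_self[of "- u"] by (intro mult_right_mono) auto
    then show ?thesis by (simp add: algebra_simps exp_minus)
  qed
  have "exp y - 1 - y \<le> y * (exp y - 1)"
    using *[of y] by (simp add: algebra_simps)
  also have "\<dots> \<le> y\<^sup>2 * exp \<bar>y\<bar>"
  proof (cases "y \<ge> 0")
    case True
    then show ?thesis
      using mult_left_mono[OF *[of y] True] by (simp add: power2_eq_square algebra_simps)
  next
    case False
    have "y * (exp y - 1) = (- y) * (1 - exp y)" by (simp add: algebra_simps)
    also have "\<dots> \<le> (- y) * (- y)"
      using False exp_ge_add_one_self[of y] by (intro mult_left_mono) (simp_all del: exp_ge_add_one_self)
    also have "\<dots> \<le> y\<^sup>2 * exp \<bar>y\<bar>"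
      using mult_left_mono[of 1 "exp \<bar>y\<bar>" "y\<^sup>2"] by (simp add: power2_eq_square)
    finally show ?thesis .
  qed
  finally show ?thesis .
qed

definition levy_integrand :: "real \<Rightarrow> real \<Rightarrow> complex" where
  "levy_integrand z x = iexp (z * x) - 1 - \<i> * of_real (z * x * indicator {x. \<bar>x\<bar> \<le> 1} x)"

lemma borel_measurable_levy_integrand [measurable]: "levy_integrand z \<in> borel_measurable borel"
  unfolding levy_integrand_def[abs_def] by measurable

text \<open>For jumps of size at most 1 the compensated exponential is quadratic by Taylor's
  formula; for larger jumps it is a difference of two numbers of modulus 1. The bound is an
  integrable majorant for every Levy measure, used for integrability and for dominated
  convergence.\<close>

lemma norm_levy_integrand_le: "norm (levy_integrand z x) \<le> (2 + z\<^sup>2) * min (x\<^sup>2) 1"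
proof (cases "\<bar>x\<bar> \<le> 1")
  case True
  have "norm (levy_integrand z x) \<le> (z * x)\<^sup>2 / 2"
    using iexp_approx1[of "z * x" 1] True by (simp add: levy_integrand_def power2_eq_square field_simps)
  also have "\<dots> \<le> (2 + z\<^sup>2) * x\<^sup>2"
    by (simp add: power_mult_distrib algebra_simps)
  also have "x\<^sup>2 = min (x\<^sup>2) 1"
    using True by (simp add: abs_square_le_1)
  finally show ?thesis .
next
  case False
  have "norm (levy_integrand z x) \<le> norm (iexp (z * x)) + norm (1 :: complex)"
    using False norm_triangle_ineq4[of "iexp (z * x)" 1] by (simp add: levy_integrand_def)
  also have "\<dots> \<le> (2 + z\<^sup>2) * 1" by simp
  also have "1 = min (x\<^sup>2) 1"
    using False abs_square_le_1[of x] by (simp add: min_def)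
  finally show ?thesis by simp
qed

text \<open>Monotone convergence along the levels n + 1. Weak convergence controls only bounded
  functions, and this passes the resulting bounds on to the unbounded exponential.\<close>

lemma nn_integral_le_if_truncations_le:
  fixes f :: "'a \<Rightarrow> real"
  assumes [measurable]: "f \<in> borel_measurable M"
    and le: "\<And>n. n > (0::nat) \<Longrightarrow> (\<integral>\<^sup>+x. ennreal (min (f x) n) * indicator A x \<partial>M) \<le> c"
    and [measurable]: "A \<in> sets M"
  shows "(\<integral>\<^sup>+x. ennreal (f x) * indicator A x \<partial>M) \<le> c"
proof -
  have sup: "(SUP n::nat. ennreal (min (f x) (Suc n)) * indicator A x) = ennreal (f x) * indicator A x" for x
  proof (rule antisym)
    show "(SUP n::nat. ennreal (min (f x) (Suc n)) * indicator A x) \<le> ennreal (f x) * indicator A x"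
      by (intro SUP_least mult_right_mono) (auto intro: ennreal_leI)
    obtain n :: nat where "f x \<le> n" using real_arch_simple by blast
    then have "ennreal (f x) * indicator A x = ennreal (min (f x) (Suc n)) * indicator A x"
      by (simp add: min_def)
    then show "ennreal (f x) * indicator A x \<le> (SUP n::nat. ennreal (min (f x) (Suc n)) * indicator A x)"
      by (auto intro: SUP_upper)
  qed
  have "(\<integral>\<^sup>+x. ennreal (f x) * indicator A x \<partial>M) =
      (SUP n::nat. \<integral>\<^sup>+x. ennreal (min (f x) (Suc n)) * indicator A x \<partial>M)"
    unfolding sup[symmetric]
    by (intro nn_integral_monotone_convergence_SUP)
       (auto intro!: incseq_SucI le_funI mult_right_mono ennreal_leI min.mono)
  also have "\<dots> \<le> c" by (intro SUP_least le) simp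
  finally show ?thesis .
qed

subsection \<open>Exponential moments of infinitely divisible laws\<close>

lemma levy_approximation:
  fixes \<mu> \<rho> :: "real measure"
  assumes sets_\<mu>: "sets \<mu> = sets borel"
    and fin: "(\<integral>\<^sup>+x. ennreal (min (x\<^sup>2) 1) \<partial>\<mu>) < \<infinity>"
    and v: "v \<ge> 0"
  obtains W :: "nat \<Rightarrow> real measure" and Z :: "real measure" where
    "\<And>n. real_distribution (W n)" "real_distribution Z"
    "\<And>z. (\<lambda>n. char (W n \<star> Z) z) \<longlonglongrightarrow>
      exp (\<i> * of_real (z * b) - of_real (z\<^sup>2 * v / 2) + (CLINT x|\<mu>. levy_integrand z x))"
    "\<And>a. \<exists>G. \<forall>n. (\<integral>\<^sup>+x. ennreal (exp (a * x)) \<partial>W n) \<le> ennreal G"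
    "\<And>a. (\<integral>\<^sup>+x\<in>{x. \<bar>x\<bar> > 1}. ennreal (exp (a * x)) \<partial>\<mu>) < \<infinity> \<Longrightarrow>
      (\<integral>\<^sup>+x. ennreal (exp (a * x)) \<partial>Z) < \<infinity>"
    "\<exists>c>0. \<forall>f\<in>borel_measurable borel. ennreal c * (\<integral>\<^sup>+x\<in>{x. \<bar>x\<bar> > 1}. f x \<partial>\<mu>) \<le> (\<integral>\<^sup>+x. f x \<partial>Z)"
proof -
  note sets_\<mu>[measurable_cong]
  have sp: "space \<mu> = UNIV" using sets_\<mu> sets_eq_imp_space_eq by force
  define w :: "real \<Rightarrow> real" where "w x = min (x\<^sup>2) 1" for x
  have [measurable]: "w \<in> borel_measurable borel" unfolding w_def[abs_def] by measurable
  have w0: "w x \<ge> 0" for x by (simp add: w_def)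
  have int_w: "integrable \<mu> w"
    using fin w0 by (intro integrableI_nonneg) (auto simp: w_def)
  define big where "big = {x::real. \<bar>x\<bar> > 1}"
  define small where "small n = {x::real. 1 / real (Suc n) < \<bar>x\<bar> \<and> \<bar>x\<bar> \<le> 1}" for n
  have [measurable]: "big \<in> sets borel" "small n \<in> sets borel" for n
    unfolding big_def small_def by measurable
  \<comment> \<open>Away from 0 the integrable weight \<open>w\<close> is bounded below, so a set
    kept by the n-th cutoff has finite measure, as a compound Poisson law requires.\<close>
  have w_lower: "1 \<le> (real (Suc n))\<^sup>2 * w x" if "x \<in> big \<union> small n" for x n
  proof -
    have "1 / real (Suc n) < \<bar>x\<bar>"
    proof (cases "x \<in> small n")
      case False
      have "1 / real (Suc n) \<le> 1" by simp
      moreover have "1 < \<bar>x\<bar>" using False that by (simp add: big_def)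
      ultimately show ?thesis by linarith
    qed (auto simp: small_def)
    then have "1 \<le> real (Suc n) * \<bar>x\<bar>" by (simp add: field_simps)
    then have "1 \<le> (real (Suc n) * \<bar>x\<bar>)\<^sup>2" by (simp add: one_le_power)
    moreover have "1 \<le> (real (Suc n))\<^sup>2" by (simp add: one_le_power)
    ultimately show ?thesis by (auto simp: w_def min_def power_mult_distrib)
  qed
  have fin_A: "emeasure \<mu> A < \<infinity>" if "A \<subseteq> big \<union> small n" and [measurable]: "A \<in> sets borel" for A n
  proof -
    have "emeasure \<mu> A = (\<integral>\<^sup>+x. indicator A x \<partial>\<mu>)" by (simp add: sets_\<mu>)
    also have "\<dots> \<le> (\<integral>\<^sup>+x. ennreal ((real (Suc n))\<^sup>2 * w x) \<partial>\<mu>)"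
      using w_lower[of _ n] that(1) w0
      by (intro nn_integral_mono) (auto simp: indicator_def ennreal_1[symmetric] simp del: ennreal_1 of_nat_Suc intro!: ennreal_leI)
    also have "\<dots> < \<infinity>"
      using int_w by (subst nn_integral_eq_integral) (auto simp: w0)
    finally show ?thesis .
  qed
  have fin_density: "finite_measure (density \<mu> (indicator A))"
    if "A \<subseteq> big \<union> small n" "A \<in> sets borel" for A n
    using fin_A[OF that] that(2)
    by (intro finite_measureI) (simp add: emeasure_density sets_\<mu> sp)
  obtain Z where Z: "real_distribution Z"
    and char_Z: "\<And>z. char Z z = exp (CLINT x|density \<mu> (indicator big). iexp (z * x) - 1)"
    and exp_Z: "\<And>a. integrable (density \<mu> (indicator big)) (\<lambda>x. exp (a * x)) \<Longrightarrow>
      (\<integral>\<^sup>+x. ennreal (exp (a * x)) \<partial>Z) =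
      ennreal (exp (LINT x|density \<mu> (indicator big). exp (a * x) - 1))"
    and lower_Z: "\<And>f :: real \<Rightarrow> ennreal. f \<in> borel_measurable borel \<Longrightarrow>
      ennreal (exp (- measure (density \<mu> (indicator big)) UNIV)) *
        (\<integral>\<^sup>+x. f x \<partial>density \<mu> (indicator big)) \<le> (\<integral>\<^sup>+x. f x \<partial>Z)"
    by (rule compound_poisson_exists[OF fin_density[of big 0]]) (auto simp: sets_\<mu>)
  have "\<exists>V. \<forall>n. real_distribution (V n) \<and>
      (\<forall>z. char (V n) z = exp (CLINT x|density \<mu> (indicator (small n)). iexp (z * x) - 1)) \<and>
      (\<forall>a. integrable (density \<mu> (indicator (small n))) (\<lambda>x. exp (a * x)) \<longrightarrow>
        (\<integral>\<^sup>+x. ennreal (exp (a * x)) \<partial>V n) =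
        ennreal (exp (LINT x|density \<mu> (indicator (small n)). exp (a * x) - 1)))"
    (is "\<exists>V. \<forall>n. ?P n (V n)")
  proof (rule choice, rule allI)
    fix n
    show "\<exists>V. ?P n V"
      by (rule compound_poisson_exists[OF fin_density[of "small n" n]]) (auto simp: sets_\<mu>)
  qed
  then obtain V where V: "\<And>n. real_distribution (V n)"
    and char_V: "\<And>n z. char (V n) z = exp (CLINT x|density \<mu> (indicator (small n)). iexp (z * x) - 1)"
    and exp_V: "\<And>n a. integrable (density \<mu> (indicator (small n))) (\<lambda>x. exp (a * x)) \<Longrightarrow>
        (\<integral>\<^sup>+x. ennreal (exp (a * x)) \<partial>V n) =
        ennreal (exp (LINT x|density \<mu> (indicator (small n)). exp (a * x) - 1))"
    by blast
  have small_le: "\<bar>x\<bar> \<le> 1" if "x \<in> small n" for x n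
    using that by (simp add: small_def)
  have fin_small: "emeasure \<mu> (small n) < \<infinity>" for n
    using fin_A[of "small n" n] by auto
  have int_dens: "(LINT x|density \<mu> (indicator A). f x) = (LINT x|\<mu>. indicator A x *\<^sub>R f x)"
    "integrable (density \<mu> (indicator A)) f \<longleftrightarrow> integrable \<mu> (\<lambda>x. indicator A x *\<^sub>R f x)"
    if [measurable]: "A \<in> sets borel" "f \<in> borel_measurable borel"
    for A and f :: "real \<Rightarrow> 'b::{banach, second_countable_topology}"
    using integral_density[of f \<mu> "indicator A"] integrable_density[of f \<mu> "indicator A"]
    by (auto simp: ennreal_indicator)
  \<comment> \<open>The mean displacement caused by the jumps in \<open>small n\<close>. Subtracting
    it from the drift of the Gaussian factor of \<open>W n\<close> is the compensation of these
    jumps.\<close>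
  define mean where "mean n = (LINT x|\<mu>. indicator (small n) x *\<^sub>R x)" for n
  have int_mean: "integrable \<mu> (\<lambda>x. indicator (small n) x *\<^sub>R x)" for n
    by (rule integrableI_bounded_set_indicator[where B=1]) (use fin_small in \<open>auto dest: small_le\<close>)
  define W where "W n = (gaussian (b - mean n) v \<star> V n)" for n
  have W: "real_distribution (W n)" for n
    unfolding W_def by (intro real_distribution_convolution real_distribution_gaussian V)
  define c where "c = exp (- measure (density \<mu> (indicator big)) UNIV)"
  show ?thesis
  proof (rule that[of W Z])
    show "real_distribution (W n)" for n by (rule W)
    show "real_distribution Z" by (rule Z)
  next
    fix z
    let ?h = "levy_integrand z"
    have int_h: "integrable \<mu> (\<lambda>x. indicator A x *\<^sub>R ?h x)" if [measurable]: "A \<in> sets borel" for A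
    proof (rule Bochner_Integration.integrable_bound)
      show "integrable \<mu> (\<lambda>x. (2 + z\<^sup>2) * w x)" using int_w by simp
      show "AE x in \<mu>. norm (indicator A x *\<^sub>R ?h x) \<le> norm ((2 + z\<^sup>2) * w x)"
        using norm_levy_integrand_le[of z] w0 by (auto simp: w_def indicator_def)
    qed measurable
    \<comment> \<open>On \<open>small n\<close> the compound Poisson exponent lacks the compensating
      term; the surplus i z \<open>mean n\<close> is cancelled by the drift of the Gaussian
      factor.\<close>
    have small_h: "(CLINT x|density \<mu> (indicator (small n)). iexp (z * x) - 1) =
        (CLINT x|\<mu>. indicator (small n) x *\<^sub>R ?h x) + \<i> * of_real (z * mean n)" for n
    proof -
      have eq: "indicator (small n) x *\<^sub>R (iexp (z * x) - 1) =
          indicator (small n) x *\<^sub>R ?h x + \<i> * of_real z * of_real (indicator (small n) x *\<^sub>R x)" for x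
        by (auto simp: levy_integrand_def small_def indicator_def)
      let ?m = "\<lambda>x. \<i> * of_real z * complex_of_real (indicator (small n) x *\<^sub>R x)"
      have i1: "integrable \<mu> (\<lambda>x. indicator (small n) x *\<^sub>R ?h x)" by (rule int_h) simp
      have i2: "integrable \<mu> ?m"
        by (intro integrable_mult_right integrable_of_real int_mean)
      have "(CLINT x|density \<mu> (indicator (small n)). iexp (z * x) - 1) =
          (CLINT x|\<mu>. indicator (small n) x *\<^sub>R (iexp (z * x) - 1))"
        by (rule int_dens) auto
      also have "\<dots> = (CLINT x|\<mu>. indicator (small n) x *\<^sub>R ?h x + ?m x)"
        unfolding eq ..
      also have "\<dots> = (CLINT x|\<mu>. indicator (small n) x *\<^sub>R ?h x) + (CLINT x|\<mu>. ?m x)"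
        by (rule Bochner_Integration.integral_add[OF i1 i2])
      also have "(CLINT x|\<mu>. ?m x) = \<i> * of_real (z * mean n)"
        unfolding mean_def
        by (simp only: integral_mult_right_zero integral_complex_of_real of_real_mult mult.assoc)
      finally show ?thesis .
    qed
    have big_h: "(CLINT x|density \<mu> (indicator big). iexp (z * x) - 1) =
        (CLINT x|\<mu>. indicator big x *\<^sub>R ?h x)"
      by (subst int_dens) (auto intro!: Bochner_Integration.integral_cong
          simp: levy_integrand_def big_def indicator_def)
    have "char (W n \<star> Z) z = exp (\<i> * of_real (z * b) - of_real (z\<^sup>2 * v / 2) +
        (CLINT x|\<mu>. indicator (small n \<union> big) x *\<^sub>R ?h x))" for n
    proof -
      have "(CLINT x|\<mu>. indicator (small n) x *\<^sub>R ?h x) + (CLINT x|\<mu>. indicator big x *\<^sub>R ?h x) =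
          (CLINT x|\<mu>. indicator (small n) x *\<^sub>R ?h x + indicator big x *\<^sub>R ?h x)"
        by (subst Bochner_Integration.integral_add) (auto intro!: int_h)
      also have "\<dots> = (CLINT x|\<mu>. indicator (small n \<union> big) x *\<^sub>R ?h x)"
        by (intro Bochner_Integration.integral_cong) (auto simp: small_def big_def indicator_def)
      finally have sum: "(CLINT x|\<mu>. indicator (small n \<union> big) x *\<^sub>R ?h x) =
        (CLINT x|\<mu>. indicator (small n) x *\<^sub>R ?h x) + (CLINT x|\<mu>. indicator big x *\<^sub>R ?h x)" ..
      have "char (W n \<star> Z) z = char (gaussian (b - mean n) v) z * char (V n) z * char Z z"
        using char_convolution[OF W Z] char_convolution[OF real_distribution_gaussian V]
        by (simp add: W_def)
      also have "\<dots> = exp (\<i> * of_real (z * (b - mean n)) - of_real (z\<^sup>2 * v / 2) +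
          ((CLINT x|\<mu>. indicator (small n) x *\<^sub>R ?h x) + \<i> * of_real (z * mean n)) +
          (CLINT x|\<mu>. indicator big x *\<^sub>R ?h x))"
        unfolding char_gaussian[OF v] char_V char_Z small_h big_h by (simp only: mult_exp_exp)
      also have "\<dots> = exp (\<i> * of_real (z * b) - of_real (z\<^sup>2 * v / 2) +
          (CLINT x|\<mu>. indicator (small n \<union> big) x *\<^sub>R ?h x))"
        unfolding sum by (rule arg_cong[where f=exp]) (simp add: algebra_simps)
      finally show ?thesis .
    qed
    moreover have "(\<lambda>n. CLINT x|\<mu>. indicator (small n \<union> big) x *\<^sub>R ?h x) \<longlonglongrightarrow> (CLINT x|\<mu>. ?h x)"
    proof (rule integral_dominated_convergence[where w="\<lambda>x. (2 + z\<^sup>2) * w x"])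
      show "integrable \<mu> (\<lambda>x. (2 + z\<^sup>2) * w x)" using int_w by simp
      show "AE x in \<mu>. norm (indicator (small n \<union> big) x *\<^sub>R ?h x) \<le> (2 + z\<^sup>2) * w x" for n
        using norm_levy_integrand_le[of z] w0 by (auto simp: w_def indicator_def)
      show "AE x in \<mu>. (\<lambda>n. indicator (small n \<union> big) x *\<^sub>R ?h x) \<longlonglongrightarrow> ?h x"
      proof (rule AE_I2)
        fix x :: real
        show "(\<lambda>n. indicator (small n \<union> big) x *\<^sub>R ?h x) \<longlonglongrightarrow> ?h x"
        proof (cases "x = 0")
          \<comment> \<open>The point 0 lies in none of the sets \<open>small n\<close> or
            \<open>big\<close>, but the integrand vanishes there.\<close>
          case True
          then show ?thesis by (simp add: levy_integrand_def)
        next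
          case False
          then obtain N where N: "inverse (real (Suc N)) < \<bar>x\<bar>"
            using reals_Archimedean[of "\<bar>x\<bar>"] by auto
          have "x \<in> small n \<union> big" if "n \<ge> N" for n
          proof -
            have "1 / real (Suc n) \<le> inverse (real (Suc N))"
              using that by (simp add: field_simps)
            with N have "1 / real (Suc n) < \<bar>x\<bar>" by linarith
            then show ?thesis by (auto simp: small_def big_def)
          qed
          then have "eventually (\<lambda>n. indicator (small n \<union> big) x *\<^sub>R ?h x = ?h x) sequentially"
            by (intro eventually_sequentiallyI[of N]) (simp add: indicator_def)
          then show ?thesis by (rule tendsto_eventually)
        qed
      qed
    qed measurable
    ultimately show "(\<lambda>n. char (W n \<star> Z) z) \<longlonglongrightarrow>
        exp (\<i> * of_real (z * b) - of_real (z\<^sup>2 * v / 2) + (CLINT x|\<mu>. ?h x))"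
      by (auto intro!: tendsto_intros)
  next
    fix a
    \<comment> \<open>The first two summands are the exponent of the Gaussian part with drift
      \<open>b\<close>. The last one majorizes the integral of exp(a x) - 1 - a x over
      \<open>small n\<close>, by the second-order bound with |a x| \<le> |a|. Integrating over the
      whole line makes the constant independent of n.\<close>
    let ?G = "exp (a * b + a\<^sup>2 * v / 2 + (LINT x|\<mu>. a\<^sup>2 * exp \<bar>a\<bar> * w x))"
    have "(\<integral>\<^sup>+x. ennreal (exp (a * x)) \<partial>W n) \<le> ennreal ?G" for n
    proof -
      have bd: "a * x \<le> \<bar>a\<bar>" if "\<bar>x\<bar> \<le> 1" for x
      proof -
        have "a * x \<le> \<bar>a\<bar> * \<bar>x\<bar>" by (metis abs_ge_self abs_mult)
        also have "\<dots> \<le> \<bar>a\<bar> * 1" using that by (intro mult_left_mono) auto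
        finally show ?thesis by simp
      qed
      have i1: "integrable \<mu> (\<lambda>x. indicator (small n) x *\<^sub>R exp (a * x))"
        by (rule integrableI_bounded_set_indicator[where B="exp \<bar>a\<bar>"]) (use fin_small bd small_le in auto)
      have i2: "integrable \<mu> (\<lambda>x. indicator (small n) x *\<^sub>R (1::real))"
        by (rule integrableI_bounded_set_indicator[where B=1]) (use fin_small in auto)
      have i3: "integrable \<mu> (\<lambda>x. indicator (small n) x *\<^sub>R (exp (a * x) - 1))"
        using Bochner_Integration.integrable_diff[OF i1 i2] by (simp add: algebra_simps)
      have i4: "integrable \<mu> (\<lambda>x. a * (indicator (small n) x *\<^sub>R x))"
        using int_mean by simp
      have "(\<integral>\<^sup>+x. ennreal (exp (a * x)) \<partial>W n) = ennreal (exp (a * (b - mean n) + a\<^sup>2 * v / 2)) *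
          ennreal (exp (LINT x|\<mu>. indicator (small n) x *\<^sub>R (exp (a * x) - 1)))"
        unfolding W_def using i1 exp_V[of n a] v
        by (subst nn_integral_exp_convolution[OF real_distribution_gaussian V])
           (simp add: nn_integral_exp_gaussian int_dens)
      also have "\<dots> = ennreal (exp (a * b + a\<^sup>2 * v / 2 +
          ((LINT x|\<mu>. indicator (small n) x *\<^sub>R (exp (a * x) - 1)) - a * mean n)))"
        by (simp add: ennreal_mult[symmetric] mult_exp_exp algebra_simps)
      also have "a * mean n = (LINT x|\<mu>. a * (indicator (small n) x *\<^sub>R x))"
        unfolding mean_def by (rule integral_mult_right_zero[symmetric])
      also have "(LINT x|\<mu>. indicator (small n) x *\<^sub>R (exp (a * x) - 1)) - \<dots> =
          (LINT x|\<mu>. indicator (small n) x *\<^sub>R (exp (a * x) - 1) - a * (indicator (small n) x *\<^sub>R x))"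
        by (rule Bochner_Integration.integral_diff[symmetric, OF i3 i4])
      also have "ennreal (exp (a * b + a\<^sup>2 * v / 2 + \<dots>)) \<le> ennreal ?G"
      proof (intro ennreal_leI exp_le_cancel_iff[THEN iffD2] add_left_mono integral_mono)
        show "integrable \<mu> (\<lambda>x. indicator (small n) x *\<^sub>R (exp (a * x) - 1) - a * (indicator (small n) x *\<^sub>R x))"
          using i3 i4 by (rule Bochner_Integration.integrable_diff)
        show "integrable \<mu> (\<lambda>x. a\<^sup>2 * exp \<bar>a\<bar> * w x)" using int_w by simp
        fix x
        show "indicator (small n) x *\<^sub>R (exp (a * x) - 1) - a * (indicator (small n) x *\<^sub>R x)
            \<le> a\<^sup>2 * exp \<bar>a\<bar> * w x"
        proof (cases "x \<in> small n")
          case True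
          then have x: "\<bar>x\<bar> \<le> 1" by (simp add: small_def)
          have "exp (a * x) - 1 - a * x \<le> (a * x)\<^sup>2 * exp \<bar>a * x\<bar>"
            by (rule exp_minus_one_minus_le)
          also have "\<dots> \<le> (a * x)\<^sup>2 * exp \<bar>a\<bar>"
            using mult_left_mono[OF x, of "\<bar>a\<bar>"] by (intro mult_left_mono) (auto simp: abs_mult)
          also have "\<dots> = a\<^sup>2 * exp \<bar>a\<bar> * w x"
            using x by (simp add: w_def min_def abs_square_le_1 power_mult_distrib)
          finally show ?thesis using True by (simp add: algebra_simps)
        qed (simp add: w0)
      qed
      finally show ?thesis .
    qed
    then show "\<exists>G. \<forall>n. (\<integral>\<^sup>+x. ennreal (exp (a * x)) \<partial>W n) \<le> ennreal G" by blast
  next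
    fix a
    assume *: "(\<integral>\<^sup>+x\<in>{x. \<bar>x\<bar> > 1}. ennreal (exp (a * x)) \<partial>\<mu>) < \<infinity>"
    have "integrable \<mu> (\<lambda>x. indicator big x *\<^sub>R exp (a * x))"
      using * by (intro integrableI_nonneg)
        (auto simp: big_def ennreal_mult ennreal_indicator[symmetric] mult.commute)
    then show "(\<integral>\<^sup>+x. ennreal (exp (a * x)) \<partial>Z) < \<infinity>"
      by (subst exp_Z) (auto simp: int_dens)
  next
    have "ennreal c * (\<integral>\<^sup>+x\<in>{x. \<bar>x\<bar> > 1}. f x \<partial>\<mu>) \<le> (\<integral>\<^sup>+x. f x \<partial>Z)"
      if [measurable]: "f \<in> borel_measurable borel" for f
      using lower_Z[of f] unfolding c_def
      by (simp add: nn_integral_density big_def[symmetric] mult.commute)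
    then show "\<exists>c>0. \<forall>f\<in>borel_measurable borel.
        ennreal c * (\<integral>\<^sup>+x\<in>{x. \<bar>x\<bar> > 1}. f x \<partial>\<mu>) \<le> (\<integral>\<^sup>+x. f x \<partial>Z)"
      by (intro exI[of _ c]) (auto simp: c_def)
  qed
qed

text \<open>Convergence of the approximating laws is only weak, so finiteness is transferred through
  truncated exponentials. The forward direction needs a uniform upper bound for the moments of
  \<open>R n\<close>. The converse needs a lower bound, obtained by confining \<open>W n\<close> to
  a fixed interval of probability at least 1/2 while \<open>Z\<close> makes one jump.\<close>

theorem levy_exp_moment_iff:
  fixes \<mu> \<rho> :: "real measure"
  assumes \<rho>: "real_distribution \<rho>" and sets_\<mu>: "sets \<mu> = sets borel"
    and fin: "(\<integral>\<^sup>+x. ennreal (min (x\<^sup>2) 1) \<partial>\<mu>) < \<infinity>" and v: "v \<ge> 0"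
    and char_\<rho>: "\<And>z. char \<rho> z =
      exp (\<i> * of_real (z * b) - of_real (z\<^sup>2 * v / 2) + (CLINT x|\<mu>. levy_integrand z x))"
  shows "(\<integral>\<^sup>+x\<in>{x. \<bar>x\<bar> > 1}. ennreal (exp (a * x)) \<partial>\<mu>) < \<infinity> \<longleftrightarrow>
    (\<integral>\<^sup>+x. ennreal (exp (a * x)) \<partial>\<rho>) < \<infinity>"
proof -
  note sets_\<mu>[measurable_cong]
  interpret \<rho>: real_distribution \<rho> by fact
  obtain W :: "nat \<Rightarrow> real measure" and Z :: "real measure" where
    W: "\<And>n. real_distribution (W n)" and Z: "real_distribution Z"
    and char_lim: "\<And>z. (\<lambda>n. char (W n \<star> Z) z) \<longlonglongrightarrow> char \<rho> z"
    and exp_W: "\<And>a. \<exists>G. \<forall>n. (\<integral>\<^sup>+x. ennreal (exp (a * x)) \<partial>W n) \<le> ennreal G"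
    and exp_Z: "\<And>a. (\<integral>\<^sup>+x\<in>{x. \<bar>x\<bar> > 1}. ennreal (exp (a * x)) \<partial>\<mu>) < \<infinity> \<Longrightarrow>
      (\<integral>\<^sup>+x. ennreal (exp (a * x)) \<partial>Z) < \<infinity>"
    and lower_Z: "\<exists>c>0. \<forall>f\<in>borel_measurable borel.
      ennreal c * (\<integral>\<^sup>+x\<in>{x. \<bar>x\<bar> > 1}. f x \<partial>\<mu>) \<le> (\<integral>\<^sup>+x. f x \<partial>Z)"
    unfolding char_\<rho> by (rule levy_approximation[OF sets_\<mu> fin v]) blast
  interpret W: real_distribution "W n" for n by (rule W)
  interpret Z: real_distribution Z by (rule Z)
  define R where "R n = (W n \<star> Z)" for n
  have R: "real_distribution (R n)" for n
    unfolding R_def by (rule real_distribution_convolution[OF W Z])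
  interpret R: real_distribution "R n" for n by (rule R)
  have weak: "weak_conv_m R \<rho>"
    using char_lim by (intro levy_continuity R \<rho>) (simp add: R_def)
  \<comment> \<open>Bounded and continuous, hence admissible as a test function for weak
    convergence, and increasing to the exponential as \<open>r\<close> grows.\<close>
  define \<phi> where "\<phi> r x = min (exp (a * x)) r" for r x :: real
  have [measurable]: "\<phi> r \<in> borel_measurable borel" for r
    unfolding \<phi>_def[abs_def] by measurable
  have \<phi>_bd: "0 \<le> \<phi> r x" "\<phi> r x \<le> r" "\<phi> r x \<le> exp (a * x)" if "r > 0" for r x
    using that by (auto simp: \<phi>_def)
  have nn_\<phi>: "(\<integral>\<^sup>+x. ennreal (\<phi> r x) \<partial>M) = ennreal (LINT x|M. \<phi> r x)"
    if "real_distribution M" "r > 0" for M r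
  proof -
    interpret M: real_distribution M by fact
    have "integrable M (\<phi> r)"
      using \<phi>_bd[OF \<open>r > 0\<close>] by (intro M.integrable_const_bound[where B=r]) auto
    then show ?thesis using \<phi>_bd[OF \<open>r > 0\<close>] by (intro nn_integral_eq_integral) auto
  qed
  have lim: "(\<lambda>n. \<integral>\<^sup>+x. ennreal (\<phi> r x) \<partial>R n) \<longlonglongrightarrow> (\<integral>\<^sup>+x. ennreal (\<phi> r x) \<partial>\<rho>)"
    if "r > 0" for r
    unfolding nn_\<phi>[OF R that] nn_\<phi>[OF \<rho> that]
  proof (intro tendsto_ennrealI weak_conv_imp_integral_bdd_continuous_conv[OF R \<rho> weak, where B=r])
    show "isCont (\<phi> r) x" for x
      unfolding \<phi>_def by (intro continuous_intros)
    show "norm (\<phi> r x) \<le> r" for x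
      using \<phi>_bd[OF that, of x] by simp
  qed
  show ?thesis
  proof
    assume "(\<integral>\<^sup>+x\<in>{x. \<bar>x\<bar> > 1}. ennreal (exp (a * x)) \<partial>\<mu>) < \<infinity>"
    then have Zfin: "(\<integral>\<^sup>+x. ennreal (exp (a * x)) \<partial>Z) < \<infinity>" by (rule exp_Z)
    obtain G where G: "\<And>n. (\<integral>\<^sup>+x. ennreal (exp (a * x)) \<partial>W n) \<le> ennreal G"
      using exp_W[of a] by blast
    let ?D = "ennreal G * (\<integral>\<^sup>+x. ennreal (exp (a * x)) \<partial>Z)"
    have R_le: "(\<integral>\<^sup>+x. ennreal (exp (a * x)) \<partial>R n) \<le> ?D" for n
      unfolding R_def nn_integral_exp_convolution[OF W Z] by (intro mult_right_mono G) simp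
    have "(\<integral>\<^sup>+x. ennreal (exp (a * x)) * indicator UNIV x \<partial>\<rho>) \<le> ?D"
    proof (rule nn_integral_le_if_truncations_le)
      fix n :: nat assume "n > 0"
      have "(\<integral>\<^sup>+x. ennreal (\<phi> n x) \<partial>\<rho>) \<le> ?D"
      proof (rule LIMSEQ_le_const2[OF lim], safe intro!: exI[of _ 0])
        fix m
        have "(\<integral>\<^sup>+x. ennreal (\<phi> n x) \<partial>R m) \<le> (\<integral>\<^sup>+x. ennreal (exp (a * x)) \<partial>R m)"
          using \<open>n > 0\<close> \<phi>_bd(3)[of n] by (intro nn_integral_mono ennreal_leI) auto
        also note R_le
        finally show "(\<integral>\<^sup>+x. ennreal (\<phi> n x) \<partial>R m) \<le> ?D" .
      qed (use \<open>n > 0\<close> in simp)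
      then show "(\<integral>\<^sup>+x. ennreal (min (exp (a * x)) n) * indicator UNIV x \<partial>\<rho>) \<le> ?D"
        by (simp add: \<phi>_def)
    qed auto
    then show "(\<integral>\<^sup>+x. ennreal (exp (a * x)) \<partial>\<rho>) < \<infinity>"
      using Zfin by (auto simp: ennreal_mult_less_top intro: le_less_trans)
  next
    let ?E = "\<integral>\<^sup>+x. ennreal (exp (a * x)) \<partial>\<rho>"
    assume Efin: "?E < \<infinity>"
    obtain c where c: "c > 0" and
      c_le: "\<And>f. f \<in> borel_measurable borel \<Longrightarrow>
        ennreal c * (\<integral>\<^sup>+x\<in>{x. \<bar>x\<bar> > 1}. f x \<partial>\<mu>) \<le> (\<integral>\<^sup>+x. f x \<partial>Z)"
      using lower_Z by blast
    obtain G1 where G1: "\<And>n. (\<integral>\<^sup>+x. ennreal (exp (1 * x)) \<partial>W n) \<le> ennreal G1"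
      using exp_W[of 1] by blast
    obtain G2 where G2: "\<And>n. (\<integral>\<^sup>+x. ennreal (exp ((-1) * x)) \<partial>W n) \<le> ennreal G2"
      using exp_W[of "-1"] by blast
    \<comment> \<open>The maxima and the added 1 give \<open>G \<ge> 1\<close> whatever the signs of
      \<open>G1\<close> and \<open>G2\<close>. With \<open>k\<close> below, exp k = 2 G, so that
      Markov's inequality yields exactly the bound 1/2.\<close>
    define G where "G = max G1 0 + max G2 0 + 1"
    define k where "k = ln (2 * G)"
    have G: "G \<ge> 1" by (simp add: G_def)
    \<comment> \<open>tightness of the small-jump parts, by Markov's inequality\<close>
    have half: "ennreal (1 / 2) \<le> emeasure (W n) {x. \<bar>x\<bar> \<le> k}" for n
    proof -
      have "ennreal (exp k) * emeasure (W n) {x. \<bar>x\<bar> > k} = (\<integral>\<^sup>+x. ennreal (exp k) * indicator {x. \<bar>x\<bar> > k} x \<partial>W n)"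
        by (subst nn_integral_cmult_indicator) auto
      also have "\<dots> \<le> (\<integral>\<^sup>+x. ennreal (exp (1 * x)) + ennreal (exp ((-1) * x)) \<partial>W n)"
      proof (rule nn_integral_mono)
        fix x :: real
        have "exp k \<le> exp x + exp (- x)" if "\<bar>x\<bar> > k"
          using that exp_le_cancel_iff[of k x] exp_le_cancel_iff[of k "- x"]
            exp_gt_zero[of x] exp_gt_zero[of "- x"]
          by (cases "x \<ge> 0") (auto simp del: exp_le_cancel_iff exp_gt_zero)
        then show "ennreal (exp k) * indicator {x. \<bar>x\<bar> > k} x \<le> ennreal (exp (1 * x)) + ennreal (exp ((-1) * x))"
          by (auto simp: indicator_def ennreal_plus[symmetric] simp del: ennreal_plus intro!: ennreal_leI)
      qed
      also have "\<dots> = (\<integral>\<^sup>+x. ennreal (exp (1 * x)) \<partial>W n) + (\<integral>\<^sup>+x. ennreal (exp ((-1) * x)) \<partial>W n)"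
        by (rule nn_integral_add) auto
      also have "\<dots> \<le> ennreal G1 + ennreal G2"
        by (intro add_mono G1 G2)
      also have "\<dots> \<le> ennreal (max G1 0) + ennreal (max G2 0)"
        by (intro add_mono ennreal_leI) auto
      also have "\<dots> \<le> ennreal G"
        by (subst ennreal_plus[symmetric]) (auto simp: G_def intro!: ennreal_leI simp del: ennreal_plus)
      finally have "ennreal (exp k * measure (W n) {x. \<bar>x\<bar> > k}) \<le> ennreal G"
        by (simp add: W.emeasure_eq_measure ennreal_mult)
      then have "exp k * measure (W n) {x. \<bar>x\<bar> > k} \<le> G"
        using G by (simp add: ennreal_le_iff)
      moreover have "exp k = 2 * G" using G by (simp add: k_def)
      ultimately have "measure (W n) {x. \<bar>x\<bar> > k} \<le> 1 / 2"
        using G by simp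
      moreover have "measure (W n) (space (W n) - {x. \<bar>x\<bar> > k}) = 1 - measure (W n) {x. \<bar>x\<bar> > k}"
        by (rule W.prob_compl) auto
      moreover have "space (W n) - {x. \<bar>x\<bar> > k} = {x. \<bar>x\<bar> \<le> k}" by auto
      ultimately have "1 / 2 \<le> measure (W n) {x. \<bar>x\<bar> \<le> k}" by simp
      then show ?thesis
        unfolding W.emeasure_eq_measure by (rule ennreal_leI)
    qed
    \<comment> \<open>The smallest possible value of exp(a x) for |x| \<le> k is at least
      \<open>d\<close>: the worst loss that adding \<open>W n\<close> can inflict on the exponential
      of the big jumps.\<close>
    define d where "d = exp (- \<bar>a\<bar> * k)"
    have d: "d > 0" by (simp add: d_def)
    define \<psi> where "\<psi> r x = min (d * exp (a * x)) r" for r x :: real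
    have [measurable]: "\<psi> r \<in> borel_measurable borel" for r
      unfolding \<psi>_def[abs_def] by measurable
    have \<psi>_le: "\<psi> r y \<le> \<phi> r (x + y)" if "\<bar>x\<bar> \<le> k" for r x y
    proof -
      have "\<bar>a * x\<bar> \<le> \<bar>a\<bar> * k"
        unfolding abs_mult using that by (intro mult_left_mono) auto
      then have "d * exp (a * y) \<le> exp (a * (x + y))"
        by (simp add: d_def mult_exp_exp distrib_left)
      then show ?thesis by (auto simp: \<psi>_def \<phi>_def)
    qed
    let ?E' = "\<integral>\<^sup>+x\<in>{x. \<bar>x\<bar> > 1}. ennreal (d * exp (a * x)) \<partial>\<mu>"
    \<comment> \<open>The factor 2/c inverts the product of 1/2, the mass of \<open>W n\<close> near
      0, and c, the weight with which \<open>Z\<close> dominates the Levy measure of the big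
      jumps.\<close>
    have "?E' \<le> ennreal (2 / c) * ?E"
    proof (rule nn_integral_le_if_truncations_le)
      fix r :: nat assume r: "r > 0"
      let ?I = "\<integral>\<^sup>+x\<in>{x. \<bar>x\<bar> > 1}. ennreal (\<psi> r x) \<partial>\<mu>"
      have "ennreal (1 / 2) * (ennreal c * ?I) \<le> (\<integral>\<^sup>+x. ennreal (\<phi> r x) \<partial>\<rho>)"
      proof (rule LIMSEQ_le_const[OF lim], safe intro!: exI[of _ 0])
        fix n
        have "ennreal (1 / 2) * (ennreal c * ?I) \<le>
            emeasure (W n) {x. \<bar>x\<bar> \<le> k} * (\<integral>\<^sup>+y. ennreal (\<psi> r y) \<partial>Z)"
          by (intro mult_mono half c_le) auto
        also have "\<dots> = (\<integral>\<^sup>+x. (\<integral>\<^sup>+y. ennreal (\<psi> r y) \<partial>Z) * indicator {x. \<bar>x\<bar> \<le> k} x \<partial>W n)"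
          by (subst nn_integral_cmult_indicator) (auto simp: mult.commute)
        also have "\<dots> \<le> (\<integral>\<^sup>+x. \<integral>\<^sup>+y. ennreal (\<phi> r (x + y)) \<partial>Z \<partial>W n)"
          by (intro nn_integral_mono)
             (auto simp: indicator_def intro!: nn_integral_mono ennreal_leI \<psi>_le)
        also have "\<dots> = (\<integral>\<^sup>+x. ennreal (\<phi> r x) \<partial>R n)"
          unfolding R_def
          by (subst nn_integral_convolution)
             (auto simp: W.finite_measure_axioms Z.finite_measure_axioms)
        finally show "ennreal (1 / 2) * (ennreal c * ?I) \<le> (\<integral>\<^sup>+x. ennreal (\<phi> r x) \<partial>R n)" .
      qed (use r in simp)
      also have "\<dots> \<le> ?E"
        using r \<phi>_bd(3)[of r] by (intro nn_integral_mono ennreal_leI) auto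
      finally have "ennreal (2 / c) * (ennreal (1 / 2) * (ennreal c * ?I)) \<le> ennreal (2 / c) * ?E"
        by (intro mult_left_mono) auto
      moreover have "ennreal (2 / c) * (ennreal (1 / 2) * (ennreal c * ?I)) = ?I"
      proof -
        have "ennreal (2 / c) * (ennreal (1 / 2) * ennreal c) = ennreal (2 / c * (1 / 2 * c))"
          using c by (subst ennreal_mult, simp, simp, subst ennreal_mult) auto
        then have "ennreal (2 / c) * (ennreal (1 / 2) * ennreal c) = 1" using c by simp
        then show ?thesis by (simp only: mult.assoc[symmetric] mult_1)
      qed
      ultimately have "?I \<le> ennreal (2 / c) * ?E" by simp
      then show "(\<integral>\<^sup>+x\<in>{x. \<bar>x\<bar> > 1}. ennreal (min (d * exp (a * x)) r) \<partial>\<mu>) \<le> ennreal (2 / c) * ?E"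
        by (simp add: \<psi>_def)
    qed auto
    also have "\<dots> < \<infinity>" using Efin by (simp add: ennreal_mult_less_top)
    also have "?E' = ennreal d * (\<integral>\<^sup>+x\<in>{x. \<bar>x\<bar> > 1}. ennreal (exp (a * x)) \<partial>\<mu>)"
      using d by (subst nn_integral_cmult[symmetric]) (auto simp: ennreal_mult mult.assoc)
    finally show "(\<integral>\<^sup>+x\<in>{x. \<bar>x\<bar> > 1}. ennreal (exp (a * x)) \<partial>\<mu>) < \<infinity>"
      using d by (auto simp: ennreal_mult_less_top)
  qed
qed

subsection \<open>The Levy measure of a kernel\<close>

text \<open>\<open>K s\<close> lives on \<open>- {0}\<close>; removing 0 from the argument turns it into a measure on the whole
  line without an atom at 0, comparable with laws on \<open>borel\<close>.\<close>

definition levy_measure :: "(real \<Rightarrow> real measure) \<Rightarrow> real \<Rightarrow> real measure" where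
  "levy_measure K t =
     measure_of UNIV (sets borel) (\<lambda>A. \<integral>\<^sup>+s\<in>{0..t}. emeasure (K s) (A - {0}) \<partial>lborel)"

lemma sets_levy_measure [simp, measurable_cong]: "sets (levy_measure K t) = sets borel"
  unfolding levy_measure_def using sets.sigma_sets_eq[of "borel :: real measure"]
  by (simp add: sets_measure_of)

text \<open>Measurability in time of integrals against a kernel is established for nonnegative
  functions. This decomposition into four nonnegative integrals carries it over to complex
  integrands.\<close>

lemma integral_complex_eq_nn_integrals:
  fixes f :: "'a \<Rightarrow> complex"
  assumes "integrable M f"
  shows "integral\<^sup>L M f =
    of_real (enn2real (\<integral>\<^sup>+x. ennreal (Re (f x)) \<partial>M) - enn2real (\<integral>\<^sup>+x. ennreal (- Re (f x)) \<partial>M)) +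
    \<i> * of_real (enn2real (\<integral>\<^sup>+x. ennreal (Im (f x)) \<partial>M) - enn2real (\<integral>\<^sup>+x. ennreal (- Im (f x)) \<partial>M))"
proof (rule complex_eqI)
  have "integrable M (\<lambda>x. Re (f x))" "integrable M (\<lambda>x. Im (f x))"
    using assms by auto
  note real_lebesgue_integral_def[OF this(1)] real_lebesgue_integral_def[OF this(2)]
  with integral_Re[OF assms] integral_Im[OF assms]
  show "Re (integral\<^sup>L M f) = Re (of_real (enn2real (\<integral>\<^sup>+x. ennreal (Re (f x)) \<partial>M) - enn2real (\<integral>\<^sup>+x. ennreal (- Re (f x)) \<partial>M)) +
    \<i> * of_real (enn2real (\<integral>\<^sup>+x. ennreal (Im (f x)) \<partial>M) - enn2real (\<integral>\<^sup>+x. ennreal (- Im (f x)) \<partial>M)))"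
   and "Im (integral\<^sup>L M f) = Im (of_real (enn2real (\<integral>\<^sup>+x. ennreal (Re (f x)) \<partial>M) - enn2real (\<integral>\<^sup>+x. ennreal (- Re (f x)) \<partial>M)) +
    \<i> * of_real (enn2real (\<integral>\<^sup>+x. ennreal (Im (f x)) \<partial>M) - enn2real (\<integral>\<^sup>+x. ennreal (- Im (f x)) \<partial>M)))"
    by simp_all
qed

lemma integral_complex_of_real_add_ii:
  assumes "integrable M g" "integrable M h"
  shows "(CLINT x|M. of_real (g x) + \<i> * of_real (h x)) =
    of_real (LINT x|M. g x) + \<i> * of_real (LINT x|M. h x)"
  using assms by (subst Bochner_Integration.integral_add) (auto simp: integral_complex_of_real)

context
  fixes K :: "real \<Rightarrow> real measure"
  assumes kernel: "levy_kernel K"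
begin

lemma
  assumes "s \<ge> 0"
  shows sets_levy_kernel: "sets (K s) = sets borel_nonzero"
    and space_levy_kernel: "space (K s) = - {0}"
proof -
  show *: "sets (K s) = sets borel_nonzero"
    using kernel assms by (simp add: levy_kernel_def)
  show "space (K s) = - {0}"
    using sets_eq_imp_space_eq[OF *] by (simp add: borel_nonzero_def space_restrict_space)
qed

lemma borel_measurable_levy_kernel:
  assumes "f \<in> borel_measurable borel" "s \<ge> 0"
  shows "f \<in> borel_measurable (K s)"
proof -
  have "f \<in> borel_measurable borel_nonzero"
    unfolding borel_nonzero_def using assms(1) by (rule measurable_restrict_space1)
  then show ?thesis
    using measurable_cong_sets[OF sets_levy_kernel[OF assms(2)] refl] by blast
qed

lemma diff_zero_sets_borel_nonzero:
  "A \<in> sets borel \<Longrightarrow> A - {0} \<in> sets borel_nonzero"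
  by (auto simp: borel_nonzero_def sets_restrict_space intro!: image_eqI[of _ _ A])

lemma emeasure_levy_kernel_measurable:
  assumes "A \<in> sets borel"
  shows "(\<lambda>s. emeasure (K s) (A - {0}) * indicator {0..t} s) \<in> borel_measurable borel"
proof -
  have "(\<lambda>s. emeasure (K s) (A - {0})) \<in> borel_measurable (restrict_space borel {0..})"
    using kernel diff_zero_sets_borel_nonzero[OF assms] by (simp add: levy_kernel_def)
  then have [measurable]: "(\<lambda>s. emeasure (K s) (A - {0}) * indicator {0..} s) \<in> borel_measurable borel"
    by (subst (asm) borel_measurable_restrict_space_iff_ennreal) auto
  have "(\<lambda>s. (emeasure (K s) (A - {0}) * indicator {0..} s) * indicator {0..t} s) \<in> borel_measurable borel"
    by measurable
  moreover have "(\<lambda>s. (emeasure (K s) (A - {0}) * indicator {0..} s) * indicator {0..t} s) =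
      (\<lambda>s. emeasure (K s) (A - {0}) * indicator {0..t} s)"
    by (auto simp: indicator_def)
  ultimately show ?thesis by simp
qed

text \<open>The values of a measure built with \<open>measure_of\<close> are the prescribed ones
  only after countable additivity has been verified; it comes from exchanging the time integral with
  a sum of nonnegative functions.\<close>

lemma emeasure_levy_measure:
  assumes "A \<in> sets borel"
  shows "emeasure (levy_measure K t) A = (\<integral>\<^sup>+s\<in>{0..t}. emeasure (K s) (A - {0}) \<partial>lborel)"
proof (rule emeasure_measure_of[OF levy_measure_def])
  let ?\<mu> = "\<lambda>A. \<integral>\<^sup>+s\<in>{0..t}. emeasure (K s) (A - {0}) \<partial>lborel"
  show "countably_additive (sets (levy_measure K t)) ?\<mu>"
    unfolding countably_additive_def
  proof (intro allI impI)
    fix A :: "nat \<Rightarrow> real set"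
    assume A: "range A \<subseteq> sets (levy_measure K t)" and disj: "disjoint_family A"
    have "(\<Sum>i. ?\<mu> (A i)) = (\<integral>\<^sup>+s. (\<Sum>i. emeasure (K s) (A i - {0}) * indicator {0..t} s) \<partial>lborel)"
      using A by (intro nn_integral_suminf[symmetric]) (auto intro!: emeasure_levy_kernel_measurable)
    also have "\<dots> = ?\<mu> (\<Union>i. A i)"
    proof (rule nn_integral_cong)
      fix s :: real
      show "(\<Sum>i. emeasure (K s) (A i - {0}) * indicator {0..t} s) =
          emeasure (K s) ((\<Union>i. A i) - {0}) * indicator {0..t} s"
      proof (cases "s \<in> {0..t}")
        case True
        have "(\<Sum>i. emeasure (K s) (A i - {0})) = emeasure (K s) (\<Union>i. A i - {0})"
          using A disj True
          by (intro suminf_emeasure)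
             (auto simp: sets_levy_kernel disjoint_family_on_def intro!: diff_zero_sets_borel_nonzero)
        also have "(\<Union>i. A i - {0}) = (\<Union>i. A i) - {0}" by auto
        finally show ?thesis using True by simp
      qed simp
    qed
    finally show "(\<Sum>i. ?\<mu> (A i)) = ?\<mu> (\<Union>i. A i)" .
  qed
qed (use assms in \<open>auto simp: positive_def\<close>)

lemma nn_integral_levy_kernel_indicator:
  assumes "A \<in> sets borel" "s \<ge> 0"
  shows "(\<integral>\<^sup>+x. indicator A x \<partial>K s) = emeasure (K s) (A - {0})"
proof -
  have "(\<integral>\<^sup>+x. indicator A x \<partial>K s) = (\<integral>\<^sup>+x. indicator (A - {0}) x \<partial>K s)"
    using assms by (intro nn_integral_cong) (auto simp: space_levy_kernel indicator_def)
  also have "\<dots> = emeasure (K s) (A - {0})"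
    using assms by (intro nn_integral_indicator) (simp add: sets_levy_kernel diff_zero_sets_borel_nonzero)
  finally show ?thesis .
qed

text \<open>Induction over nonnegative Borel functions. The two claims are proved together, because
  additivity and monotone convergence of the time integral in each step require measurability in
  time of the inner integrals.\<close>

lemma
  fixes f :: "real \<Rightarrow> ennreal"
  assumes "f \<in> borel_measurable borel"
  shows borel_measurable_nn_integral_levy_kernel [measurable]:
      "(\<lambda>s. (\<integral>\<^sup>+x. f x \<partial>K s) * indicator {0..t} s) \<in> borel_measurable borel"
    and nn_integral_levy_measure:
      "(\<integral>\<^sup>+x. f x \<partial>levy_measure K t) = (\<integral>\<^sup>+s\<in>{0..t}. (\<integral>\<^sup>+x. f x \<partial>K s) \<partial>lborel)"
proof -
  have "(\<lambda>s. (\<integral>\<^sup>+x. f x \<partial>K s) * indicator {0..t} s) \<in> borel_measurable borel \<and>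
      (\<integral>\<^sup>+x. f x \<partial>levy_measure K t) = (\<integral>\<^sup>+s\<in>{0..t}. (\<integral>\<^sup>+x. f x \<partial>K s) \<partial>lborel)"
    (is "?Q f")
    using assms
  proof (induction rule: borel_measurable_induct)
    case (cong f g)
    then have "f = g" by auto
    with cong show ?case by simp
  next
    case (set A)
    have eq: "(\<integral>\<^sup>+x. indicator A x \<partial>K s) * indicator {0..t} s = emeasure (K s) (A - {0}) * indicator {0..t} s" for s
      using set nn_integral_levy_kernel_indicator[of A s] by (auto simp: indicator_def)
    have "(\<integral>\<^sup>+x. indicator A x \<partial>levy_measure K t) = emeasure (levy_measure K t) A"
      using set by (intro nn_integral_indicator) simp
    also have "\<dots> = (\<integral>\<^sup>+s\<in>{0..t}. emeasure (K s) (A - {0}) \<partial>lborel)"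
      by (rule emeasure_levy_measure[OF set])
    also have "\<dots> = (\<integral>\<^sup>+s\<in>{0..t}. (\<integral>\<^sup>+x. indicator A x \<partial>K s) \<partial>lborel)"
      by (intro nn_integral_cong) (rule eq[symmetric])
    finally have int: "(\<integral>\<^sup>+x. indicator A x \<partial>levy_measure K t) =
        (\<integral>\<^sup>+s\<in>{0..t}. (\<integral>\<^sup>+x. indicator A x \<partial>K s) \<partial>lborel)" .
    have meas: "(\<lambda>s. (\<integral>\<^sup>+x. indicator A x \<partial>K s) * indicator {0..t} s) \<in> borel_measurable borel"
      using emeasure_levy_kernel_measurable[OF set, of t] by (simp only: eq)
    show ?case by (rule conjI[OF meas int])
  next
    case (mult u c)
    have eq: "(\<integral>\<^sup>+x. c * u x \<partial>K s) * indicator {0..t} s = c * ((\<integral>\<^sup>+x. u x \<partial>K s) * indicator {0..t} s)" for s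
      using borel_measurable_levy_kernel[OF \<open>u \<in> borel_measurable borel\<close>, of s]
      by (cases "s \<in> {0..t}") (auto simp: nn_integral_cmult)
    have meas: "(\<lambda>s. (\<integral>\<^sup>+x. u x \<partial>K s) * indicator {0..t} s) \<in> borel_measurable borel"
      and int: "(\<integral>\<^sup>+x. u x \<partial>levy_measure K t) = (\<integral>\<^sup>+s\<in>{0..t}. (\<integral>\<^sup>+x. u x \<partial>K s) \<partial>lborel)"
      using mult by blast+
    have "(\<integral>\<^sup>+x. c * u x \<partial>levy_measure K t) = c * (\<integral>\<^sup>+x. u x \<partial>levy_measure K t)"
      using \<open>u \<in> borel_measurable borel\<close> by (intro nn_integral_cmult) simp
    moreover have "(\<integral>\<^sup>+s. c * ((\<integral>\<^sup>+x. u x \<partial>K s) * indicator {0..t} s) \<partial>lborel) =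
        c * (\<integral>\<^sup>+s\<in>{0..t}. (\<integral>\<^sup>+x. u x \<partial>K s) \<partial>lborel)"
      using meas by (intro nn_integral_cmult) simp
    ultimately show ?case
      unfolding eq int by (intro conjI borel_measurable_times_ennreal[OF borel_measurable_const meas]) simp_all
  next
    case (add u v)
    have eq: "(\<integral>\<^sup>+x. v x + u x \<partial>K s) * indicator {0..t} s =
        (\<integral>\<^sup>+x. v x \<partial>K s) * indicator {0..t} s + (\<integral>\<^sup>+x. u x \<partial>K s) * indicator {0..t} s" for s
      using borel_measurable_levy_kernel[OF \<open>u \<in> borel_measurable borel\<close>, of s]
        borel_measurable_levy_kernel[OF \<open>v \<in> borel_measurable borel\<close>, of s]
      by (cases "s \<in> {0..t}") (auto simp: nn_integral_add)
    have meas: "(\<lambda>s. (\<integral>\<^sup>+x. u x \<partial>K s) * indicator {0..t} s) \<in> borel_measurable borel"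
        "(\<lambda>s. (\<integral>\<^sup>+x. v x \<partial>K s) * indicator {0..t} s) \<in> borel_measurable borel"
      and int: "(\<integral>\<^sup>+x. u x \<partial>levy_measure K t) = (\<integral>\<^sup>+s\<in>{0..t}. (\<integral>\<^sup>+x. u x \<partial>K s) \<partial>lborel)"
        "(\<integral>\<^sup>+x. v x \<partial>levy_measure K t) = (\<integral>\<^sup>+s\<in>{0..t}. (\<integral>\<^sup>+x. v x \<partial>K s) \<partial>lborel)"
      using add by blast+
    have "(\<integral>\<^sup>+x. v x + u x \<partial>levy_measure K t) =
        (\<integral>\<^sup>+x. v x \<partial>levy_measure K t) + (\<integral>\<^sup>+x. u x \<partial>levy_measure K t)"
      using \<open>u \<in> borel_measurable borel\<close> \<open>v \<in> borel_measurable borel\<close>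
      by (intro nn_integral_add) simp_all
    moreover have "(\<integral>\<^sup>+s. (\<integral>\<^sup>+x. v x \<partial>K s) * indicator {0..t} s +
          (\<integral>\<^sup>+x. u x \<partial>K s) * indicator {0..t} s \<partial>lborel) =
        (\<integral>\<^sup>+s\<in>{0..t}. (\<integral>\<^sup>+x. v x \<partial>K s) \<partial>lborel) + (\<integral>\<^sup>+s\<in>{0..t}. (\<integral>\<^sup>+x. u x \<partial>K s) \<partial>lborel)"
      using meas by (intro nn_integral_add) simp_all
    ultimately show ?case
      unfolding eq int by (intro conjI borel_measurable_add[OF meas(2) meas(1)]) simp_all
  next
    case (seq U)
    have Sup: "(SUP i. U i) x = (SUP i. U i x)" for x by (simp add: image_comp)
    have U: "U i \<in> borel_measurable borel" for i by (rule seq)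
    have meas: "(\<lambda>s. (\<integral>\<^sup>+x. U i x \<partial>K s) * indicator {0..t} s) \<in> borel_measurable borel"
      and int: "(\<integral>\<^sup>+x. U i x \<partial>levy_measure K t) = (\<integral>\<^sup>+s\<in>{0..t}. (\<integral>\<^sup>+x. U i x \<partial>K s) \<partial>lborel)" for i
      using seq by blast+
    have le: "U i x \<le> U j x" if "i \<le> j" for i j x
      using \<open>incseq U\<close> that by (simp add: incseq_def le_fun_def)
    have inc: "incseq (\<lambda>i s. (\<integral>\<^sup>+x. U i x \<partial>K s) * indicator {0..t} s)"
      unfolding incseq_def le_fun_def by (intro allI impI mult_right_mono nn_integral_mono le) auto
    have eq: "(\<integral>\<^sup>+x. (SUP i. U i) x \<partial>K s) * indicator {0..t} s =
        (SUP i. (\<integral>\<^sup>+x. U i x \<partial>K s) * indicator {0..t} s)" for s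
    proof (cases "s \<in> {0..t}")
      case True
      then have "(\<integral>\<^sup>+x. (SUP i. U i) x \<partial>K s) = (SUP i. \<integral>\<^sup>+x. U i x \<partial>K s)"
        unfolding Sup
        by (intro nn_integral_monotone_convergence_SUP \<open>incseq U\<close> borel_measurable_levy_kernel U) auto
      with True show ?thesis by simp
    qed simp
    have "(\<integral>\<^sup>+x. (SUP i. U i) x \<partial>levy_measure K t) = (SUP i. \<integral>\<^sup>+x. U i x \<partial>levy_measure K t)"
      unfolding Sup using U by (intro nn_integral_monotone_convergence_SUP \<open>incseq U\<close>) simp
    also have "\<dots> = (SUP i. \<integral>\<^sup>+s\<in>{0..t}. (\<integral>\<^sup>+x. U i x \<partial>K s) \<partial>lborel)"
      unfolding int ..
    also have "\<dots> = (\<integral>\<^sup>+s. (SUP i. (\<integral>\<^sup>+x. U i x \<partial>K s) * indicator {0..t} s) \<partial>lborel)"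
      using meas by (intro nn_integral_monotone_convergence_SUP[symmetric] inc) simp
    finally show ?case
      unfolding eq by (intro conjI borel_measurable_SUP[OF _ meas]) simp_all
  qed
  then show "(\<lambda>s. (\<integral>\<^sup>+x. f x \<partial>K s) * indicator {0..t} s) \<in> borel_measurable borel"
    and "(\<integral>\<^sup>+x. f x \<partial>levy_measure K t) = (\<integral>\<^sup>+s\<in>{0..t}. (\<integral>\<^sup>+x. f x \<partial>K s) \<partial>lborel)"
    by auto
qed

text \<open>Fubini's theorem for the kernel: integrability against the Levy measure gives
  integrability against \<open>K s\<close> only for almost every \<open>s\<close>. The inner
  integral is therefore replaced by a combination \<open>F\<close> of nonnegative integrals, to
  which the previous lemma applies.\<close>

lemma integral_levy_measure:
  fixes f :: "real \<Rightarrow> complex"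
  assumes [measurable]: "f \<in> borel_measurable borel" and int: "integrable (levy_measure K t) f"
  shows "(CLBINT s:{0..t}. (CLINT x|K s. f x)) = (CLINT x|levy_measure K t. f x)"
proof -
  define P where "P g s = (\<integral>\<^sup>+x. ennreal (g x) \<partial>K s) * indicator {0..t} s" for g :: "real \<Rightarrow> real" and s :: real
  have P_meas [measurable]: "P g \<in> borel_measurable borel" if "g \<in> borel_measurable borel" for g
    unfolding P_def[abs_def] using that by measurable
  have P_int: "(\<integral>\<^sup>+s. P g s \<partial>lborel) = (\<integral>\<^sup>+x. ennreal (g x) \<partial>levy_measure K t)"
    if "g \<in> borel_measurable borel" for g
    unfolding P_def using that by (subst nn_integral_levy_measure) auto
  have N_fin: "(\<integral>\<^sup>+x. ennreal (norm (f x)) \<partial>levy_measure K t) < \<infinity>"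
    using int by (simp add: integrable_iff_bounded)
  have AE_fin: "AE s in lborel. P (\<lambda>x. norm (f x)) s \<noteq> \<infinity>"
    using N_fin by (intro nn_integral_PInf_AE) (auto simp: P_int)
  define F where "F s = (of_real (enn2real (P (\<lambda>x. Re (f x)) s) - enn2real (P (\<lambda>x. - Re (f x)) s)) +
      \<i> * of_real (enn2real (P (\<lambda>x. Im (f x)) s) - enn2real (P (\<lambda>x. - Im (f x)) s)) :: complex)" for s
  have [measurable]: "F \<in> borel_measurable borel" unfolding F_def[abs_def] by measurable
  \<comment> \<open>Where \<open>f\<close> is not integrable against \<open>K s\<close>, the Bochner
    integral takes its default value 0. These times form a null set by
    \<open>AE_fin\<close>.\<close>
  have eq: "indicator {0..t} s *\<^sub>R (CLINT x|K s. f x) =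
      (if P (\<lambda>x. norm (f x)) s < \<infinity> then F s else 0)" for s
  proof (cases "s \<in> {0..t}")
    case True
    show ?thesis
    proof (cases "integrable (K s) f")
      case int: True
      then have "P (\<lambda>x. norm (f x)) s < \<infinity>"
        using True by (simp add: integrable_iff_bounded P_def)
      with True show ?thesis
        by (simp add: F_def P_def integral_complex_eq_nn_integrals[OF int])
    next
      case False
      have "f \<in> borel_measurable (K s)"
        using True by (intro borel_measurable_levy_kernel) auto
      with False True have "\<not> P (\<lambda>x. norm (f x)) s < \<infinity>"
        by (simp add: integrable_iff_bounded P_def)
      then show ?thesis using False by (simp add: not_integrable_integral_eq)
    qed
  qed (simp add: P_def F_def)
  have P_has: "integrable lborel (\<lambda>s. enn2real (P g s))"
      "(LINT s|lborel. enn2real (P g s)) = enn2real (\<integral>\<^sup>+x. ennreal (g x) \<partial>levy_measure K t)"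
    if [measurable]: "g \<in> borel_measurable borel" and le: "\<And>x. g x \<le> norm (f x)" for g
  proof -
    have "(\<integral>\<^sup>+x. ennreal (g x) \<partial>levy_measure K t) \<le> (\<integral>\<^sup>+x. ennreal (norm (f x)) \<partial>levy_measure K t)"
      using le by (intro nn_integral_mono ennreal_leI) auto
    then have fin: "(\<integral>\<^sup>+x. ennreal (g x) \<partial>levy_measure K t) < \<infinity>"
      using N_fin by (rule le_less_trans)
    then have "AE s in lborel. P g s \<noteq> \<infinity>"
      by (intro nn_integral_PInf_AE) (auto simp: P_int)
    then have "(\<integral>\<^sup>+s. ennreal (enn2real (P g s)) \<partial>lborel) = (\<integral>\<^sup>+s. P g s \<partial>lborel)"
      by (intro nn_integral_cong_AE) (auto simp: less_top)
    then have *: "(\<integral>\<^sup>+s. ennreal (enn2real (P g s)) \<partial>lborel) = (\<integral>\<^sup>+x. ennreal (g x) \<partial>levy_measure K t)"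
      by (simp add: P_int)
    show "integrable lborel (\<lambda>s. enn2real (P g s))"
      using fin * by (intro integrableI_nonneg) auto
    show "(LINT s|lborel. enn2real (P g s)) = enn2real (\<integral>\<^sup>+x. ennreal (g x) \<partial>levy_measure K t)"
      unfolding *[symmetric] by (rule integral_eq_nn_integral) auto
  qed
  have le: "Re (f x) \<le> norm (f x)" "- Re (f x) \<le> norm (f x)"
    "Im (f x) \<le> norm (f x)" "- Im (f x) \<le> norm (f x)" for x
    using abs_Re_le_cmod[of "f x"] abs_Im_le_cmod[of "f x"] by auto
  have "(CLBINT s:{0..t}. (CLINT x|K s. f x)) = (CLINT s|lborel. if P (\<lambda>x. norm (f x)) s < \<infinity> then F s else 0)"
    unfolding set_lebesgue_integral_def eq ..
  also have "\<dots> = (CLINT s|lborel. F s)"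
    using AE_fin by (intro integral_cong_AE) (auto simp: less_top)
  also have "\<dots> = (CLINT x|levy_measure K t. f x)"
    unfolding F_def integral_complex_eq_nn_integrals[OF int]
    using P_has le by (subst integral_complex_of_real_add_ii) simp_all
  finally show ?thesis .
qed

end

text \<open>The law of \<open>Y\<close> is infinitely divisible with Levy measure
  \<open>levy_measure K t\<close>. Turning the iterated integrals, in the exponent as well as in the
  moment condition, into integrals against this measure reduces the claim to
  \<open>levy_exp_moment_iff\<close>.\<close>

lemma exp_moment_iff_condition_A:
  fixes Y :: "'a \<Rightarrow> real"
  assumes "prob_space M" and [measurable]: "Y \<in> borel_measurable M"
    and kernel: "levy_kernel K"
    and fin: "(\<integral>\<^sup>+s\<in>{0..t}. (\<integral>\<^sup>+x. ennreal (min (x\<^sup>2) 1) \<partial>K s) \<partial>lborel) < \<infinity>"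
    and v: "v \<ge> 0"
    and char_Y: "\<And>z. (CLINT \<omega>|M. exp (\<i> * of_real (z * Y \<omega>))) =
      exp (\<i> * of_real (z * b) - of_real (z\<^sup>2 * v / 2) +
        (CLBINT s:{0..t}. (CLINT x|K s. levy_integrand z x)))"
  shows "condition_A K t \<alpha> \<longleftrightarrow> (\<integral>\<^sup>+\<omega>. ennreal (exp (- \<alpha> * Y \<omega>)) \<partial>M) < \<infinity>"
proof -
  interpret prob_space M by fact
  let ?\<mu> = "levy_measure K t" and ?\<rho> = "distr M borel Y"
  have min_fin: "(\<integral>\<^sup>+x. ennreal (min (x\<^sup>2) 1) \<partial>?\<mu>) < \<infinity>"
    using fin by (subst nn_integral_levy_measure[OF kernel]) auto
  have int: "integrable ?\<mu> (levy_integrand z)" for z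
  proof (rule Bochner_Integration.integrable_bound)
    show "integrable ?\<mu> (\<lambda>x. (2 + z\<^sup>2) * min (x\<^sup>2) 1)"
      using min_fin by (intro integrable_mult_right integrableI_nonneg) auto
    show "AE x in ?\<mu>. norm (levy_integrand z x) \<le> norm ((2 + z\<^sup>2) * min (x\<^sup>2) 1)"
      using norm_levy_integrand_le[of z] by (intro AE_I2) (simp add: abs_mult)
  qed simp
  have char: "char ?\<rho> z = exp (\<i> * of_real (z * b) - of_real (z\<^sup>2 * v / 2) +
      (CLINT x|?\<mu>. levy_integrand z x))" for z
  proof -
    have "char ?\<rho> z = (CLINT \<omega>|M. exp (\<i> * of_real (z * Y \<omega>)))"
      unfolding char_def by (subst integral_distr) auto
    then show ?thesis
      unfolding char_Y integral_levy_measure[OF kernel borel_measurable_levy_integrand int] .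
  qed
  have "condition_A K t \<alpha> \<longleftrightarrow> (\<integral>\<^sup>+x\<in>{x. \<bar>x\<bar> > 1}. ennreal (exp (- \<alpha> * x)) \<partial>?\<mu>) < \<infinity>"
    unfolding condition_A_def by (subst nn_integral_levy_measure[OF kernel]) auto
  also have "\<dots> \<longleftrightarrow> (\<integral>\<^sup>+x. ennreal (exp (- \<alpha> * x)) \<partial>?\<rho>) < \<infinity>"
    by (rule levy_exp_moment_iff[OF _ _ min_fin v char]) auto
  also have "(\<integral>\<^sup>+x. ennreal (exp (- \<alpha> * x)) \<partial>?\<rho>) = (\<integral>\<^sup>+\<omega>. ennreal (exp (- \<alpha> * Y \<omega>)) \<partial>M)"
    by (subst nn_integral_distr) auto
  finally show ?thesis .
qed

subsection \<open>Bounds along cadlag paths\<close>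

text \<open>The one-sided limits bound the path near every point, and bisection of [0, t] makes this
  local bound global.\<close>

lemma cadlag_bounded:
  assumes "cadlag f" "t \<ge> 0"
  obtains k where "\<And>s. s \<in> {0..t} \<Longrightarrow> \<bar>f s\<bar> \<le> k"
proof -
  have ev_bd: "\<exists>e. eventually (\<lambda>s. \<bar>f s\<bar> \<le> e) F" if "(f \<longlongrightarrow> l) F" for l F
  proof -
    have "eventually (\<lambda>s. dist (f s) l < 1) F" using that by (rule tendstoD) simp
    then show ?thesis
      by (intro exI[of _ "\<bar>l\<bar> + 1"]) (auto simp: dist_real_def elim!: eventually_mono)
  qed
  \<comment> \<open>The intersection with the nonnegative half-line is needed because the intervals
    around 0 reach negative times, about which \<open>cadlag\<close> says nothing.\<close>
  let ?P = "\<lambda>a b. \<exists>k. \<forall>s\<in>{a..b} \<inter> {0..}. \<bar>f s\<bar> \<le> k"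
  have "?P 0 t"
  proof (rule Bolzano[where P="?P"])
    fix a b c :: real assume "?P a b" "?P b c"
    then obtain k1 k2 where k: "\<forall>s\<in>{a..b} \<inter> {0..}. \<bar>f s\<bar> \<le> k1" "\<forall>s\<in>{b..c} \<inter> {0..}. \<bar>f s\<bar> \<le> k2"
      by blast
    show "?P a c"
    proof (intro exI[of _ "max k1 k2"] ballI)
      fix s assume "s \<in> {a..c} \<inter> {0..}"
      with k show "\<bar>f s\<bar> \<le> max k1 k2" by (cases "s \<le> b") (force simp: le_max_iff_disj)+
    qed
  next
    fix x :: real assume x: "0 \<le> x" "x \<le> t"
    obtain e1 where "eventually (\<lambda>s. \<bar>f s\<bar> \<le> e1) (at_right x)"
      using assms x ev_bd unfolding cadlag_def by blast
    then obtain u where u: "u > x" "\<And>s. x < s \<Longrightarrow> s < u \<Longrightarrow> \<bar>f s\<bar> \<le> e1"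
      unfolding eventually_at_right_field by blast
    obtain w e2 where w: "w < x" "\<And>s. 0 \<le> s \<Longrightarrow> w < s \<Longrightarrow> s < x \<Longrightarrow> \<bar>f s\<bar> \<le> e2"
    proof (cases "x = 0")
      \<comment> \<open>There is no nonnegative time to the left of 0, so any bound will do.\<close>
      case True
      then show ?thesis using that[of "-1" 0] by auto
    next
      case False
      then obtain l where "(f \<longlongrightarrow> l) (at_left x)" using assms x unfolding cadlag_def by force
      then obtain e2 where "eventually (\<lambda>s. \<bar>f s\<bar> \<le> e2) (at_left x)" using ev_bd by blast
      then show ?thesis using that unfolding eventually_at_left_field by blast
    qed
    show "\<exists>d>0. \<forall>a b. a \<le> x \<and> x \<le> b \<and> b - a < d \<longrightarrow> ?P a b"
    proof (rule exI[of _ "min (u - x) (x - w)"], intro conjI allI impI)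
      show "min (u - x) (x - w) > 0" using u w by simp
      fix a b assume ab: "a \<le> x \<and> x \<le> b \<and> b - a < min (u - x) (x - w)"
      show "?P a b"
      proof (intro exI[of _ "max \<bar>f x\<bar> (max e1 e2)"] ballI)
        fix s assume s: "s \<in> {a..b} \<inter> {0..}"
        consider "s < x" | "s = x" | "s > x" by linarith
        then show "\<bar>f s\<bar> \<le> max \<bar>f x\<bar> (max e1 e2)"
        proof cases
          case 1
          then have "\<bar>f s\<bar> \<le> e2" using s ab by (intro w(2)) auto
          then show ?thesis by simp
        next
          case 3
          then have "\<bar>f s\<bar> \<le> e1" using s ab by (intro u(2)) auto
          then show ?thesis by simp
        qed simp
      qed
    qed
  qed (use assms in simp)
  then obtain k where "\<forall>s\<in>{0..t} \<inter> {0..}. \<bar>f s\<bar> \<le> k" by blast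
  then show ?thesis by (intro that[of k]) auto
qed

text \<open>For s \<ge> 0 this is the least multiple of 1/(n+1) strictly above s; strictness lets it
  approach s from the right even when s is itself a multiple. Since \<open>nat\<close> cuts off at
  0, negative arguments give the same value as 0.\<close>

definition right_grid :: "nat \<Rightarrow> real \<Rightarrow> real" where
  "right_grid n s = (real (nat \<lfloor>real (Suc n) * s\<rfloor>) + 1) / real (Suc n)"

lemma right_grid_bounds:
  assumes "s \<ge> 0"
  shows "s < right_grid n s" "right_grid n s \<le> s + 1 / real (Suc n)"
proof -
  have "real (nat \<lfloor>real (Suc n) * s\<rfloor>) = of_int \<lfloor>real (Suc n) * s\<rfloor>"
    using assms by (simp del: of_nat_Suc)
  moreover have "real (Suc n) * s < of_int \<lfloor>real (Suc n) * s\<rfloor> + 1"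
    "of_int \<lfloor>real (Suc n) * s\<rfloor> \<le> real (Suc n) * s"
    by (linarith, rule of_int_floor_le)
  ultimately show "s < right_grid n s" "right_grid n s \<le> s + 1 / real (Suc n)"
    by (simp_all add: right_grid_def field_simps del: of_nat_Suc)
qed

lemma filterlim_right_grid:
  assumes "s \<ge> 0"
  shows "filterlim (\<lambda>n. right_grid n s) (at_right s) sequentially"
  unfolding filterlim_at
proof (intro conjI)
  show "(\<lambda>n. right_grid n s) \<longlonglongrightarrow> s"
  proof (rule tendsto_sandwich[OF _ _ tendsto_const])
    show "(\<lambda>n. s + 1 / real (Suc n)) \<longlonglongrightarrow> s"
      using tendsto_add[OF tendsto_const LIMSEQ_inverse_real_of_nat, of s] by (simp add: inverse_eq_divide)
  qed (use right_grid_bounds[OF assms] in \<open>auto intro!: always_eventually less_imp_le\<close>)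
  show "\<forall>\<^sub>F n in sequentially. right_grid n s \<in> {s<..} \<and> right_grid n s \<noteq> s"
    using right_grid_bounds[OF assms] by (auto intro!: always_eventually) (metis less_irrefl)
qed

section \<open>Jensen's inequality for powers\<close>

text \<open>A convex function lies above its tangent at m. Scaling by m reduces this to Bernoulli's
  inequality for u = y/m, which is derived from convexity of the exponential at suitable
  logarithms.\<close>

lemma powr_ge_tangent:
  fixes \<alpha> m y :: real
  assumes \<alpha>: "\<alpha> \<ge> 1 \<or> \<alpha> \<le> 0" and m: "m > 0" and y: "y > 0"
  shows "m powr \<alpha> + \<alpha> * m powr (\<alpha> - 1) * (y - m) \<le> y powr \<alpha>"
proof -
  define u where "u = y / m"
  have u: "u > 0" using m y by (simp add: u_def)
  have "1 + \<alpha> * (u - 1) \<le> u powr \<alpha>"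
  proof (cases "\<alpha> \<ge> 1")
    case True
    \<comment> \<open>Here ln u is the combination of 0 and \<alpha> ln u with weights 1 -
      1/\<alpha> and 1/\<alpha>.\<close>
    have "exp ((1 - 1 / \<alpha>) *\<^sub>R 0 + (1 / \<alpha>) *\<^sub>R (\<alpha> * ln u)) \<le> (1 - 1 / \<alpha>) * exp 0 + (1 / \<alpha>) * exp (\<alpha> * ln u)"
      using True by (intro convex_onD[OF exp_convex]) auto
    then have "u \<le> (1 - 1 / \<alpha>) + (1 / \<alpha>) * u powr \<alpha>"
      using True u by (simp add: powr_def)
    then have "\<alpha> * u \<le> \<alpha> * ((1 - 1 / \<alpha>) + (1 / \<alpha>) * u powr \<alpha>)"
      using True by (intro mult_left_mono) auto
    also have "\<dots> = \<alpha> - 1 + u powr \<alpha>"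
      using True by (simp add: field_simps)
    finally show ?thesis by (simp add: algebra_simps)
  next
    case False
    with \<alpha> have \<alpha>: "\<alpha> \<le> 0" by simp
    have scale: "q * ((1 - 1 / q) * u + (1 / q) * p) = (q - 1) * u + p" if "q > 0" for p q u :: real
      using that by (simp add: field_simps)
    \<comment> \<open>For \<alpha> \<le> 0 the roles change: 0 is the combination of ln u and
      \<alpha> ln u, the latter with weight 1/(1 - \<alpha>).\<close>
    have "exp ((1 - 1 / (1 - \<alpha>)) *\<^sub>R ln u + (1 / (1 - \<alpha>)) *\<^sub>R (\<alpha> * ln u)) \<le>
        (1 - 1 / (1 - \<alpha>)) * exp (ln u) + (1 / (1 - \<alpha>)) * exp (\<alpha> * ln u)"
      using \<alpha> by (intro convex_onD[OF exp_convex]) auto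
    moreover have "(1 - 1 / (1 - \<alpha>)) *\<^sub>R ln u + (1 / (1 - \<alpha>)) *\<^sub>R (\<alpha> * ln u) = 0"
      using \<alpha> by (simp add: field_simps)
    ultimately have "1 \<le> (1 - 1 / (1 - \<alpha>)) * u + (1 / (1 - \<alpha>)) * u powr \<alpha>"
      using u by (simp add: powr_def)
    then have "(1 - \<alpha>) * 1 \<le> (1 - \<alpha>) * ((1 - 1 / (1 - \<alpha>)) * u + (1 / (1 - \<alpha>)) * u powr \<alpha>)"
      using \<alpha> by (intro mult_left_mono) auto
    also have "\<dots> = - \<alpha> * u + u powr \<alpha>"
      using scale[of "1 - \<alpha>" u "u powr \<alpha>"] \<alpha> by simp
    finally show ?thesis by (simp add: algebra_simps)
  qed
  then have "m powr \<alpha> * (1 + \<alpha> * (u - 1)) \<le> m powr \<alpha> * u powr \<alpha>"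
    by (intro mult_left_mono) auto
  also have "\<dots> = y powr \<alpha>"
    using m y by (simp add: u_def powr_mult[symmetric])
  also have "m powr \<alpha> * (1 + \<alpha> * (u - 1)) = m powr \<alpha> + \<alpha> * m powr (\<alpha> - 1) * (y - m)"
    using m by (simp add: u_def powr_diff field_simps)
  finally show ?thesis .
qed

text \<open>Jensen's inequality for normalized Lebesgue measure on [0, t]: the tangent inequality at
  the mean m = I/t is integrated over time. Boundedness of the path makes all integrals finite and I
  strictly positive, so that the tangent at m exists also for negative exponents.\<close>

lemma integral_exp_powr_le:
  fixes f :: "real \<Rightarrow> real"
  assumes [measurable]: "f \<in> borel_measurable borel"
    and k: "\<And>s. s \<in> {0..t} \<Longrightarrow> \<bar>f s\<bar> \<le> k"
    and t: "t > 0" and \<alpha>: "\<alpha> \<ge> 1 \<or> \<alpha> \<le> 0"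
  shows "ennreal ((LBINT s:{0..t}. exp (- f s)) powr \<alpha>) \<le>
    ennreal (t powr (\<alpha> - 1)) * (\<integral>\<^sup>+s\<in>{0..t}. ennreal (exp (- \<alpha> * f s)) \<partial>lborel)"
proof -
  have int: "set_integrable lborel {0..t} (\<lambda>s. exp (a * f s))" for a
    unfolding set_integrable_def
  proof (rule integrableI_bounded_set_indicator[where B="exp (\<bar>a\<bar> * k)"])
    have "a * f s \<le> \<bar>a\<bar> * k" if "s \<in> {0..t}" for s
    proof -
      have "a * f s \<le> \<bar>a\<bar> * \<bar>f s\<bar>" by (metis abs_ge_self abs_mult)
      also have "\<dots> \<le> \<bar>a\<bar> * k" using k[OF that] by (intro mult_left_mono) auto
      finally show ?thesis .
    qed
    then show "AE s in lborel. s \<in> {0..t} \<longrightarrow> norm (exp (a * f s)) \<le> exp (\<bar>a\<bar> * k)" by auto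
    show "emeasure lborel {0..t} < \<infinity>" using t by simp
  qed auto
  have int_const: "set_integrable lborel {0..t} (\<lambda>s. c :: real)" for c
    unfolding set_integrable_def
    by (rule integrableI_bounded_set_indicator[where B="\<bar>c\<bar>"]) (use t in auto)
  have const: "(LBINT s:{0..t}. c) = t * c" for c :: real
    using t by (simp add: set_lebesgue_integral_def)
  define I where "I = (LBINT s:{0..t}. exp (- f s))"
  define J where "J = (LBINT s:{0..t}. exp (- \<alpha> * f s))"
  have "t * exp (- k) \<le> I"
    unfolding I_def const[symmetric] using int[of "-1"] k
    by (intro set_integral_mono int_const) (auto simp: abs_le_iff)
  then have I: "I > 0" using t by (smt (verit) exp_gt_zero mult_pos_pos)
  define m where "m = I / t"
  have m: "m > 0" using I t by (simp add: m_def)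
  \<comment> \<open>The tangent at \<open>m\<close>, evaluated at exp(-f s) and split into a
    constant and a multiple of exp(-f s). Its linear deviation integrates to zero because t m =
    I.\<close>
  let ?T = "\<lambda>s. (m powr \<alpha> - \<alpha> * m powr (\<alpha> - 1) * m) + \<alpha> * m powr (\<alpha> - 1) * exp (- f s)"
  have intT: "set_integrable lborel {0..t} ?T"
    using int[of "-1"] by (intro set_integral_add set_integrable_mult_right int_const) simp
  have "(LBINT s:{0..t}. ?T s) = t * (m powr \<alpha> - \<alpha> * m powr (\<alpha> - 1) * m) + \<alpha> * m powr (\<alpha> - 1) * I"
    using int[of "-1"] by (subst set_integral_add) (auto simp: const I_def int_const)
  also have "\<dots> = t * m powr \<alpha>"
    using t by (simp add: m_def field_simps)
  finally have "t * m powr \<alpha> = (LBINT s:{0..t}. ?T s)" ..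
  also have "\<dots> \<le> J"
    unfolding J_def
  proof (rule set_integral_mono[OF intT int])
    fix s
    show "?T s \<le> exp (- \<alpha> * f s)"
      using powr_ge_tangent[OF \<alpha> m, of "exp (- f s)"]
      by (simp add: powr_def algebra_simps)
  qed
  finally have "t powr (\<alpha> - 1) * (t * m powr \<alpha>) \<le> t powr (\<alpha> - 1) * J"
    by (intro mult_left_mono) auto
  also have "t powr (\<alpha> - 1) * (t * m powr \<alpha>) = I powr \<alpha>"
    using t I by (simp add: m_def powr_divide powr_diff field_simps)
  finally have "ennreal (I powr \<alpha>) \<le> ennreal (t powr (\<alpha> - 1) * J)" by (rule ennreal_leI)
  also have "\<dots> = ennreal (t powr (\<alpha> - 1)) * ennreal J"
    by (rule ennreal_mult') simp
  also have "ennreal J = (\<integral>\<^sup>+s\<in>{0..t}. ennreal (exp (- \<alpha> * f s)) \<partial>lborel)"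
  proof -
    have "integrable lborel (\<lambda>s. indicator {0..t} s *\<^sub>R exp (- \<alpha> * f s))"
      using int[of "- \<alpha>"] by (simp add: set_integrable_def)
    then have "(\<integral>\<^sup>+s. ennreal (indicator {0..t} s *\<^sub>R exp (- \<alpha> * f s)) \<partial>lborel) = ennreal J"
      unfolding J_def set_lebesgue_integral_def by (intro nn_integral_eq_integral) auto
    moreover have "ennreal (indicator {0..t} s *\<^sub>R exp (- \<alpha> * f s)) =
        ennreal (exp (- \<alpha> * f s)) * indicator {0..t} s" for s
      by (simp add: indicator_def)
    ultimately show ?thesis by simp
  qed
  finally show ?thesis by (simp add: I_def)
qed

subsection \<open>Moments of the process and of its exponential functional\<close>

text \<open>Right-continuity makes the process a pointwise limit of processes read off at grid
  times. Each of these uses countably many random variables and is jointly measurable. The maximum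
  with 0 avoids negative times, where \<open>X\<close> is unconstrained.\<close>

lemma borel_measurable_cadlag_process:
  assumes X_rv: "\<And>s. s \<ge> 0 \<Longrightarrow> X s \<in> borel_measurable M"
    and cadlag: "\<And>\<omega>. \<omega> \<in> space M \<Longrightarrow> cadlag (\<lambda>s. X s \<omega>)"
  shows "(\<lambda>(\<omega>, s). X (max 0 s) \<omega> :: real) \<in> borel_measurable (M \<Otimes>\<^sub>M borel)"
proof (rule borel_measurable_LIMSEQ_real)
  fix p assume p: "p \<in> space (M \<Otimes>\<^sub>M (borel :: real measure))"
  obtain \<omega> s where ps: "p = (\<omega>, s)" "\<omega> \<in> space M"
    using p by (cases p) (auto simp: space_pair_measure)
  \<comment> \<open>All negative times share the grid point of time 0, matching the maximum in the
    limit.\<close>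
  have grid: "right_grid n s = right_grid n (max 0 s)" for n
  proof (cases "s \<ge> 0")
    case False
    then have "real (Suc n) * s \<le> 0" by (intro mult_nonneg_nonpos) auto
    then have "nat \<lfloor>real (Suc n) * s\<rfloor> = 0" by (simp del: of_nat_Suc)
    with False show ?thesis by (simp add: right_grid_def max_def del: of_nat_Suc)
  qed (simp add: max_def)
  have "((\<lambda>u. X u \<omega>) \<longlongrightarrow> X (max 0 s) \<omega>) (at_right (max 0 s))"
    using cadlag[OF ps(2)] by (auto simp: cadlag_def)
  then have "(\<lambda>n. X (right_grid n (max 0 s)) \<omega>) \<longlonglongrightarrow> X (max 0 s) \<omega>"
    by (rule filterlim_compose) (rule filterlim_right_grid, simp)
  then show "(\<lambda>n. (\<lambda>(\<omega>, s). X (right_grid n s) \<omega>) p) \<longlonglongrightarrow> (\<lambda>(\<omega>, s). X (max 0 s) \<omega>) p"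
    by (simp add: ps grid)
next
  fix n
  have "(\<lambda>p. X ((real (nat \<lfloor>real (Suc n) * snd p\<rfloor>) + 1) / real (Suc n)) (fst p))
      \<in> borel_measurable (M \<Otimes>\<^sub>M (borel :: real measure))"
  proof (rule measurable_compose_countable[where f="\<lambda>k p. X ((real k + 1) / real (Suc n)) (fst p)"])
    fix k :: nat
    have [measurable]: "X ((real k + 1) / real (Suc n)) \<in> borel_measurable M" by (rule X_rv) simp
    show "(\<lambda>p. X ((real k + 1) / real (Suc n)) (fst p)) \<in> borel_measurable (M \<Otimes>\<^sub>M borel)"
      by measurable
  qed measurable
  then show "(\<lambda>(\<omega>, s). X (right_grid n s) \<omega>) \<in> borel_measurable (M \<Otimes>\<^sub>M borel)"
    by (simp add: right_grid_def case_prod_beta)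
qed

lemma borel_measurable_exp_functional:
  assumes X_rv: "\<And>s. s \<ge> 0 \<Longrightarrow> X s \<in> borel_measurable M"
    and cadlag: "\<And>\<omega>. \<omega> \<in> space M \<Longrightarrow> cadlag (\<lambda>s. X s \<omega>)"
  shows "exp_functional X t \<in> borel_measurable M"
proof -
  have "(\<lambda>(\<omega>, s). X (max 0 s) \<omega>) \<in> borel_measurable (M \<Otimes>\<^sub>M borel)"
    by (rule borel_measurable_cadlag_process[OF X_rv cadlag])
  then have [measurable]: "(\<lambda>(\<omega>, s). X (max 0 s) \<omega>) \<in> borel_measurable (M \<Otimes>\<^sub>M lborel)"
    by (simp cong: measurable_cong_sets)
  have "exp_functional X t = (\<lambda>\<omega>. LINT s|lborel. indicator {0..t} s *\<^sub>R exp (- X (max 0 s) \<omega>))"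
    unfolding exp_functional_def set_lebesgue_integral_def
    by (intro ext Bochner_Integration.integral_cong) (auto simp: indicator_def)
  also have "\<dots> \<in> borel_measurable M" by measurable
  finally show ?thesis .
qed

section \<open>Comparison of exponential moments at different times\<close>

context prob_space
begin

text \<open>Each path is bounded on [0, t], so the events that all increments up to t are at most k
  increase to the whole space; one of them has probability above 1/2. The resulting k does not
  depend on s.\<close>

lemma cadlag_increments_bounded_in_probability:
  assumes X_rv: "\<And>s. s \<ge> 0 \<Longrightarrow> X s \<in> borel_measurable M"
    and cadlag: "\<And>\<omega>. \<omega> \<in> space M \<Longrightarrow> cadlag (\<lambda>s. X s \<omega>)"
    and t: "t \<ge> 0"
  obtains k :: real where "k \<ge> 0"
    "\<And>s. s \<in> {0..t} \<Longrightarrow> ennreal (1 / 2) \<le> emeasure M {\<omega>\<in>space M. \<bar>X t \<omega> - X s \<omega>\<bar> \<le> k}"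
proof -
  \<comment> \<open>Only countably many times occur, which makes the event measurable; the minimum
    keeps them within [0, t].\<close>
  define E where "E k = {\<omega>\<in>space M. \<forall>n j :: nat.
      \<bar>X t \<omega> - X (min t ((real j + 1) / real (Suc n))) \<omega>\<bar> \<le> real k}" for k :: nat
  have E_meas: "E k \<in> sets M" for k
  proof -
    have [measurable]: "X t \<in> borel_measurable M"
        "X (min t ((real j + 1) / real (Suc n))) \<in> borel_measurable M" for n j :: nat
      using t by (auto intro!: X_rv)
    show ?thesis unfolding E_def by measurable
  qed
  \<comment> \<open>Right-continuity extends the bound from grid times to all s < t: grid points
    above s eventually lie below t, so the minimum with t has no effect.\<close>
  have E_sup: "\<bar>X t \<omega> - X s \<omega>\<bar> \<le> real k" if \<omega>: "\<omega> \<in> E k" and s: "s \<in> {0..t}" for \<omega> s k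
  proof (cases "s = t")
    case False
    then have st: "0 \<le> s" "s < t" using s by auto
    have "\<omega> \<in> space M" using \<omega> by (simp add: E_def)
    then have "((\<lambda>u. X u \<omega>) \<longlongrightarrow> X s \<omega>) (at_right s)"
      using cadlag st by (auto simp: cadlag_def)
    then have "(\<lambda>n. X (right_grid n s) \<omega>) \<longlonglongrightarrow> X s \<omega>"
      by (rule filterlim_compose) (rule filterlim_right_grid[OF st(1)])
    then have "(\<lambda>n. \<bar>X t \<omega> - X (right_grid n s) \<omega>\<bar>) \<longlonglongrightarrow> \<bar>X t \<omega> - X s \<omega>\<bar>"
      by (intro tendsto_intros)
    moreover have "eventually (\<lambda>n. \<bar>X t \<omega> - X (right_grid n s) \<omega>\<bar> \<le> real k) sequentially"
    proof -
      have "eventually (\<lambda>u. u < t) (at_right s)"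
        using st(2) by (auto simp: eventually_at_right_field)
      then have "eventually (\<lambda>n. right_grid n s < t) sequentially"
        using filterlim_right_grid[OF st(1)] by (auto simp: filterlim_iff)
      then show ?thesis
      proof eventually_elim
        case (elim n)
        have "\<bar>X t \<omega> - X (min t (right_grid n s)) \<omega>\<bar> \<le> real k"
          using \<omega> unfolding E_def right_grid_def by blast
        with elim show ?case by (simp add: min_def)
      qed
    qed
    ultimately show ?thesis by (rule tendsto_upperbound) simp
  qed simp
  have "incseq E"
  proof (intro monoI subsetI)
    fix m n \<omega> assume "m \<le> n" "\<omega> \<in> E m"
    then show "\<omega> \<in> E n"
      unfolding E_def mem_Collect_eq by (meson of_nat_mono order_trans)
  qed
  then have "(\<lambda>k. prob (E k)) \<longlonglongrightarrow> prob (\<Union>k. E k)"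
    using E_meas by (intro finite_Lim_measure_incseq) auto
  also have "(\<Union>k. E k) = space M"
  proof (intro equalityI subsetI)
    fix \<omega> assume \<omega>: "\<omega> \<in> space M"
    obtain k where k: "\<And>s. s \<in> {0..t} \<Longrightarrow> \<bar>X s \<omega>\<bar> \<le> k"
      using cadlag_bounded[OF cadlag[OF \<omega>] t] by blast
    obtain n :: nat where n: "2 * k \<le> real n" using real_arch_simple by blast
    have "\<bar>X t \<omega> - X (min t q) \<omega>\<bar> \<le> real n" if "q \<ge> 0" for q
      using k[of t] k[of "min t q"] t n that by auto
    then have "\<omega> \<in> E n" using \<omega> by (simp add: E_def)
    then show "\<omega> \<in> (\<Union>k. E k)" by blast
  qed (auto simp: E_def)
  finally have "(\<lambda>k. prob (E k)) \<longlonglongrightarrow> 1" by (simp add: prob_space)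
  then have "eventually (\<lambda>k. prob (E k) > 1 / 2) sequentially"
    by (rule order_tendstoD) simp
  then obtain k where k: "prob (E k) > 1 / 2"
    by (auto simp: eventually_sequentially)
  show thesis
  proof (rule that[of "real k"])
    fix s assume s: "s \<in> {0..t}"
    have [measurable]: "X t \<in> borel_measurable M" "X s \<in> borel_measurable M"
      using s t by (auto intro!: X_rv)
    have "ennreal (1 / 2) \<le> emeasure M (E k)"
      unfolding emeasure_eq_measure using k by (intro ennreal_leI) simp
    also have "\<dots> \<le> emeasure M {\<omega>\<in>space M. \<bar>X t \<omega> - X s \<omega>\<bar> \<le> real k}"
      using E_sup s by (intro emeasure_mono) (auto simp: E_def)
    finally show "ennreal (1 / 2) \<le> emeasure M {\<omega>\<in>space M. \<bar>X t \<omega> - X s \<omega>\<bar> \<le> real k}" .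
  qed simp
qed

text \<open>The value at t splits into two independent increments. The endpoints s = 0 and s = t are
  treated apart, since \<open>independent_increments\<close> speaks of strictly increasing
  times.\<close>

lemma exp_moment_independent_increments:
  assumes X_rv: "\<And>s. s \<ge> 0 \<Longrightarrow> X s \<in> borel_measurable M"
    and X_0: "\<And>\<omega>. \<omega> \<in> space M \<Longrightarrow> X 0 \<omega> = 0"
    and indep: "independent_increments M X"
    and s: "s \<in> {0..t}"
  shows "(\<integral>\<^sup>+\<omega>. ennreal (exp (a * X t \<omega>)) \<partial>M) =
    (\<integral>\<^sup>+\<omega>. ennreal (exp (a * X s \<omega>)) \<partial>M) * (\<integral>\<^sup>+\<omega>. ennreal (exp (a * (X t \<omega> - X s \<omega>))) \<partial>M)"
proof -
  consider "s = 0" | "s = t" | "0 < s" "s < t" using s by fastforce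
  then show ?thesis
  proof cases
    case 1
    then have "(\<integral>\<^sup>+\<omega>. ennreal (exp (a * X s \<omega>)) \<partial>M) = (\<integral>\<^sup>+\<omega>. 1 \<partial>M)"
      using X_0 by (intro nn_integral_cong) simp
    moreover have "(\<integral>\<^sup>+\<omega>. ennreal (exp (a * (X t \<omega> - X s \<omega>))) \<partial>M) = (\<integral>\<^sup>+\<omega>. ennreal (exp (a * X t \<omega>)) \<partial>M)"
      using 1 X_0 by (intro nn_integral_cong) simp
    ultimately show ?thesis by (simp add: emeasure_space_1)
  next
    case 2
    then show ?thesis by (simp add: emeasure_space_1)
  next
    case 3
    define \<tau> where "\<tau> i = (if i = 0 then 0 else if i = 1 then s else t)" for i :: nat
    define Y where "Y i \<omega> = X (\<tau> (Suc i)) \<omega> - X (\<tau> i) \<omega>" for i \<omega>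
    have "strict_mono_on {..2} \<tau>"
      using 3 by (auto simp: strict_mono_on_def \<tau>_def)
    then have "indep_vars (\<lambda>_. borel) Y {..<2}"
      using indep[unfolded independent_increments_def, rule_format, of \<tau> 2]
      by (simp add: Y_def[abs_def] \<tau>_def[of 0])
    then have "indep_vars (\<lambda>_. borel) (\<lambda>i \<omega>. ennreal (exp (a * Y i \<omega>))) {..<2}"
      by (rule indep_vars_compose2) measurable
    then have "(\<integral>\<^sup>+\<omega>. (\<Prod>i<2. ennreal (exp (a * Y i \<omega>))) \<partial>M) =
        (\<Prod>i<2. \<integral>\<^sup>+\<omega>. ennreal (exp (a * Y i \<omega>)) \<partial>M)"
      by (intro indep_vars_nn_integral) auto
    moreover have "(\<integral>\<^sup>+\<omega>. (\<Prod>i<2. ennreal (exp (a * Y i \<omega>))) \<partial>M) = (\<integral>\<^sup>+\<omega>. ennreal (exp (a * X t \<omega>)) \<partial>M)"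
      using X_0 by (intro nn_integral_cong)
        (simp add: Y_def \<tau>_def numeral_2_eq_2 ennreal_mult[symmetric] exp_add[symmetric] algebra_simps)
    moreover have "(\<integral>\<^sup>+\<omega>. ennreal (exp (a * Y 0 \<omega>)) \<partial>M) = (\<integral>\<^sup>+\<omega>. ennreal (exp (a * X s \<omega>)) \<partial>M)"
      using X_0 by (intro nn_integral_cong) (simp add: Y_def \<tau>_def)
    moreover have "(\<integral>\<^sup>+\<omega>. ennreal (exp (a * Y 1 \<omega>)) \<partial>M) = (\<integral>\<^sup>+\<omega>. ennreal (exp (a * (X t \<omega> - X s \<omega>))) \<partial>M)"
      by (simp add: Y_def \<tau>_def)
    ultimately show ?thesis by (simp add: numeral_2_eq_2)
  qed
qed

text \<open>The moment at t is the moment at s times that of the increment. The latter is at least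
  e/2 for every s \<le> t, because the increment is bounded by k with probability at least 1/2;
  dividing gives the constant 2/e.\<close>

lemma exp_moment_uniformly_bounded:
  assumes X_rv: "\<And>s. s \<ge> 0 \<Longrightarrow> X s \<in> borel_measurable M"
    and cadlag: "\<And>\<omega>. \<omega> \<in> space M \<Longrightarrow> cadlag (\<lambda>s. X s \<omega>)"
    and X_0: "\<And>\<omega>. \<omega> \<in> space M \<Longrightarrow> X 0 \<omega> = 0"
    and indep: "independent_increments M X" and t: "t \<ge> 0"
  obtains k where "\<And>s. s \<in> {0..t} \<Longrightarrow>
    (\<integral>\<^sup>+\<omega>. ennreal (exp (a * X s \<omega>)) \<partial>M) \<le> ennreal k * (\<integral>\<^sup>+\<omega>. ennreal (exp (a * X t \<omega>)) \<partial>M)"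
proof -
  obtain k where k: "k \<ge> 0"
    "\<And>s. s \<in> {0..t} \<Longrightarrow> ennreal (1 / 2) \<le> emeasure M {\<omega>\<in>space M. \<bar>X t \<omega> - X s \<omega>\<bar> \<le> k}"
    using cadlag_increments_bounded_in_probability[of X, OF X_rv cadlag t] by blast
  define e where "e = exp (- \<bar>a\<bar> * k)"
  have e: "e > 0" by (simp add: e_def)
  show ?thesis
  proof (rule that[of "2 / e"])
    fix s assume s: "s \<in> {0..t}"
    let ?A = "{\<omega>\<in>space M. \<bar>X t \<omega> - X s \<omega>\<bar> \<le> k}"
    let ?F = "\<integral>\<^sup>+\<omega>. ennreal (exp (a * X s \<omega>)) \<partial>M"
    let ?D = "\<integral>\<^sup>+\<omega>. ennreal (exp (a * (X t \<omega> - X s \<omega>))) \<partial>M"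
    have [measurable]: "X t \<in> borel_measurable M" "X s \<in> borel_measurable M"
      using s t by (auto intro!: X_rv)
    have "ennreal e * ennreal (1 / 2) \<le> ennreal e * emeasure M ?A"
      using k(2)[OF s] by (intro mult_left_mono) auto
    also have "\<dots> = (\<integral>\<^sup>+\<omega>. ennreal e * indicator ?A \<omega> \<partial>M)"
      by (rule nn_integral_cmult_indicator[symmetric]) measurable
    also have "\<dots> \<le> ?D"
    proof (rule nn_integral_mono)
      fix \<omega>
      have "e \<le> exp (a * (X t \<omega> - X s \<omega>))" if "\<omega> \<in> ?A"
      proof -
        have "\<bar>a * (X t \<omega> - X s \<omega>)\<bar> \<le> \<bar>a\<bar> * k"
          unfolding abs_mult using that by (intro mult_left_mono) auto
        then show ?thesis unfolding e_def by simp
      qed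
      then show "ennreal e * indicator ?A \<omega> \<le> ennreal (exp (a * (X t \<omega> - X s \<omega>)))"
        by (cases "\<omega> \<in> ?A") (auto intro!: ennreal_leI)
    qed
    finally have D: "ennreal (e / 2) \<le> ?D"
      using e by (subst (asm) ennreal_mult[symmetric]) auto
    have "?F = ennreal (2 / e) * ennreal (e / 2) * ?F"
      using e by (simp add: ennreal_mult[symmetric])
    also have "\<dots> \<le> ennreal (2 / e) * (?F * ?D)"
      using D by (simp only: mult.assoc mult.commute[of "ennreal (e / 2)"])
        (intro mult_left_mono, auto)
    also have "?F * ?D = (\<integral>\<^sup>+\<omega>. ennreal (exp (a * X t \<omega>)) \<partial>M)"
      by (rule exp_moment_independent_increments[of X, OF X_rv X_0 indep s, symmetric])
    finally show "?F \<le> ennreal (2 / e) * (\<integral>\<^sup>+\<omega>. ennreal (exp (a * X t \<omega>)) \<partial>M)" .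
  qed
qed

text \<open>Jensen's inequality is applied path by path, then expectation and time integral are
  exchanged by Tonelli. The inner moments are bounded uniformly on [0, t] by the one at t.\<close>

lemma exp_functional_powr_moment_finite:
  assumes X_rv: "\<And>s. s \<ge> 0 \<Longrightarrow> X s \<in> borel_measurable M"
    and cadlag: "\<And>\<omega>. \<omega> \<in> space M \<Longrightarrow> cadlag (\<lambda>s. X s \<omega>)"
    and X_0: "\<And>\<omega>. \<omega> \<in> space M \<Longrightarrow> X 0 \<omega> = 0"
    and indep: "independent_increments M X" and t: "t > 0"
    and \<alpha>: "\<alpha> \<ge> 1 \<or> \<alpha> \<le> 0"
    and fin: "(\<integral>\<^sup>+\<omega>. ennreal (exp (- \<alpha> * X t \<omega>)) \<partial>M) < \<infinity>"
  shows "(\<integral>\<^sup>+\<omega>. ennreal (exp_functional X t \<omega> powr \<alpha>) \<partial>M) < \<infinity>"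
proof -
  interpret P: pair_sigma_finite M lborel ..
  \<comment> \<open>Agrees with \<open>X\<close> on [0, t] and is jointly measurable on the whole
    time line, as Tonelli's theorem requires.\<close>
  let ?Y = "\<lambda>\<omega> s. X (max 0 s) \<omega>"
  have "(\<lambda>(\<omega>, s). ?Y \<omega> s) \<in> borel_measurable (M \<Otimes>\<^sub>M borel)"
    by (rule borel_measurable_cadlag_process[OF X_rv cadlag])
  then have joint [measurable]: "(\<lambda>(\<omega>, s). ?Y \<omega> s) \<in> borel_measurable (M \<Otimes>\<^sub>M lborel)"
    by (simp cong: measurable_cong_sets)
  obtain k where k: "\<And>s. s \<in> {0..t} \<Longrightarrow> (\<integral>\<^sup>+\<omega>. ennreal (exp (- \<alpha> * X s \<omega>)) \<partial>M) \<le>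
      ennreal k * (\<integral>\<^sup>+\<omega>. ennreal (exp (- \<alpha> * X t \<omega>)) \<partial>M)"
    using exp_moment_uniformly_bounded[of X, OF X_rv cadlag X_0 indep less_imp_le[OF t]] by blast
  let ?c = "ennreal (t powr (\<alpha> - 1))" and ?D = "ennreal k * (\<integral>\<^sup>+\<omega>. ennreal (exp (- \<alpha> * X t \<omega>)) \<partial>M)"
  have "(\<integral>\<^sup>+\<omega>. ennreal (exp_functional X t \<omega> powr \<alpha>) \<partial>M) \<le>
      (\<integral>\<^sup>+\<omega>. ?c * (\<integral>\<^sup>+s\<in>{0..t}. ennreal (exp (- \<alpha> * ?Y \<omega> s)) \<partial>lborel) \<partial>M)"
  proof (rule nn_integral_mono)
    fix \<omega> assume \<omega>: "\<omega> \<in> space M"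
    have meas: "?Y \<omega> \<in> borel_measurable borel"
      using measurable_compose[OF measurable_Pair1'[OF \<omega>] joint] by simp
    obtain b where b: "\<And>s. s \<in> {0..t} \<Longrightarrow> \<bar>X s \<omega>\<bar> \<le> b"
      using cadlag_bounded[OF cadlag[OF \<omega>] less_imp_le[OF t]] by blast
    have "exp_functional X t \<omega> = (LBINT s:{0..t}. exp (- ?Y \<omega> s))"
      unfolding exp_functional_def by (rule set_lebesgue_integral_cong) auto
    then show "ennreal (exp_functional X t \<omega> powr \<alpha>) \<le>
        ?c * (\<integral>\<^sup>+s\<in>{0..t}. ennreal (exp (- \<alpha> * ?Y \<omega> s)) \<partial>lborel)"
      using integral_exp_powr_le[OF meas, of t b \<alpha>] b t \<alpha> by simp
  qed
  also have "\<dots> = ?c * (\<integral>\<^sup>+\<omega>. (\<integral>\<^sup>+s\<in>{0..t}. ennreal (exp (- \<alpha> * ?Y \<omega> s)) \<partial>lborel) \<partial>M)"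
    by (rule nn_integral_cmult) measurable
  also have "(\<integral>\<^sup>+\<omega>. (\<integral>\<^sup>+s\<in>{0..t}. ennreal (exp (- \<alpha> * ?Y \<omega> s)) \<partial>lborel) \<partial>M) =
      (\<integral>\<^sup>+s. \<integral>\<^sup>+\<omega>. ennreal (exp (- \<alpha> * ?Y \<omega> s)) * indicator {0..t} s \<partial>M \<partial>lborel)"
    by (rule P.Fubini'[symmetric]) measurable
  also have "\<dots> \<le> (\<integral>\<^sup>+s. ?D * indicator {0..t} s \<partial>lborel)"
  proof (rule nn_integral_mono)
    fix s
    show "(\<integral>\<^sup>+\<omega>. ennreal (exp (- \<alpha> * ?Y \<omega> s)) * indicator {0..t} s \<partial>M) \<le> ?D * indicator {0..t} s"
      using k[of s] by (cases "s \<in> {0..t}") simp_all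
  qed
  also have "\<dots> = ?D * ennreal t"
    using t by (subst nn_integral_cmult_indicator) auto
  finally have "(\<integral>\<^sup>+\<omega>. ennreal (exp_functional X t \<omega> powr \<alpha>) \<partial>M) \<le> ?c * (?D * ennreal t)"
    by (simp add: mult_left_mono)
  also have "\<dots> < \<infinity>" using fin by (simp add: ennreal_mult_less_top)
  finally show ?thesis .
qed

end

section \<open>The moment criterion and its consequences for the exponential functional\<close>

theorem proposition1:
  fixes M :: "'a measure" and X :: "real \<Rightarrow> 'a \<Rightarrow> real"
    and b c B C :: "real \<Rightarrow> real" and K :: "real \<Rightarrow> real measure"
    and \<alpha> t :: real
  assumes "prob_space M"
    and X_rv: "\<And>s. s \<ge> 0 \<Longrightarrow> X s \<in> borel_measurable M"
    and X_cadlag: "\<And>\<omega>. \<omega> \<in> space M \<Longrightarrow> cadlag (\<lambda>s. X s \<omega>)"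
    and X_0: "\<And>\<omega>. \<omega> \<in> space M \<Longrightarrow> X 0 \<omega> = 0"
    and X_indep: "independent_increments M X"
    and X_semimart: "semimartingale M (natural_filtration M X) X"
    and b_meas: "b \<in> borel_measurable (restrict_space borel {0..})"
    and c_meas: "c \<in> borel_measurable (restrict_space borel {0..})"
    and c_nonneg: "\<And>s. s \<ge> 0 \<Longrightarrow> c s \<ge> 0"
    and b_int: "\<And>u. u \<ge> 0 \<Longrightarrow> set_integrable lborel {0..u} b"
    and c_int: "\<And>u. u \<ge> 0 \<Longrightarrow> set_integrable lborel {0..u} c"
    and B_eq: "\<And>u. u \<ge> 0 \<Longrightarrow> B u = (LBINT s:{0..u}. b s)"
    and C_eq: "\<And>u. u \<ge> 0 \<Longrightarrow> C u = (LBINT s:{0..u}. c s)"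
    and K_kernel: "levy_kernel K"
    and K_int: "\<And>u. u \<ge> 0 \<Longrightarrow>
      (\<integral>\<^sup>+s\<in>{0..u}. (\<integral>\<^sup>+x. ennreal (min (x\<^sup>2) 1) \<partial>K s) \<partial>lborel) < \<infinity>"
    and X_triplet: "deterministic_triplet M (natural_filtration M X) X B C K"
    and X_char: "\<And>u z. u \<ge> 0 \<Longrightarrow>
      (CLINT \<omega>|M. exp (\<i> * of_real (z * X u \<omega>))) =
      exp (\<i> * of_real (z * B u) - of_real (z\<^sup>2 * C u / 2) +
        (CLBINT s:{0..u}. (CLINT x|K s.
           exp (\<i> * of_real (z * x)) - 1 - \<i> * of_real (z * x * indicator {x. \<bar>x\<bar> \<le> 1} x))))"
    and "t > 0"
  shows "(condition_A K t \<alpha> \<longleftrightarrow> (\<integral>\<^sup>+\<omega>. ennreal (exp (- \<alpha> * X t \<omega>)) \<partial>M) < \<infinity>) \<and>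
    (\<alpha> \<ge> 1 \<or> \<alpha> \<le> 0 \<longrightarrow> condition_A K t \<alpha> \<longrightarrow>
      (\<integral>\<^sup>+\<omega>. ennreal (exp_functional X t \<omega> powr \<alpha>) \<partial>M) < \<infinity>) \<and>
    (condition_A K t 1 \<longrightarrow>
      (\<forall>\<beta>. 0 \<le> \<beta> \<and> \<beta> \<le> 1 \<longrightarrow>
        (\<integral>\<^sup>+\<omega>. ennreal (exp_functional X t \<omega> powr \<beta>) \<partial>M) < \<infinity>))"
proof -
  interpret prob_space M by fact
  have t: "t \<ge> 0" using \<open>t > 0\<close> by simp
  \<comment> \<open>\<open>C t\<close> takes the part of the Gaussian variance
    \<open>v\<close>.\<close>
  have "C t \<ge> 0"
    unfolding C_eq[OF t] set_lebesgue_integral_def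
    by (intro Bochner_Integration.integral_nonneg) (auto simp: indicator_def c_nonneg)
  then have iff: "condition_A K t a \<longleftrightarrow> (\<integral>\<^sup>+\<omega>. ennreal (exp (- a * X t \<omega>)) \<partial>M) < \<infinity>" for a
    using X_char[OF t]
    by (intro exp_moment_iff_condition_A[OF \<open>prob_space M\<close> X_rv[OF t] K_kernel K_int[OF t], where b = "B t"])
       (simp_all add: levy_integrand_def)
  have powr_moment: "(\<integral>\<^sup>+\<omega>. ennreal (exp_functional X t \<omega> powr a) \<partial>M) < \<infinity>"
    if "a \<ge> 1 \<or> a \<le> 0" "condition_A K t a" for a
    using that iff
    by (intro exp_functional_powr_moment_finite[of X, OF X_rv X_cadlag X_0 X_indep \<open>t > 0\<close>]) auto
  \<comment> \<open>Exponents between 0 and 1 escape the convexity argument. They are dominated by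
    the case of exponent 1 through I^\<beta> \<le> 1 + I, at the cost of the finite mass of
    \<open>M\<close>.\<close>
  have "(\<integral>\<^sup>+\<omega>. ennreal (exp_functional X t \<omega> powr \<beta>) \<partial>M) < \<infinity>"
    if A1: "condition_A K t 1" and \<beta>: "0 \<le> \<beta>" "\<beta> \<le> 1" for \<beta>
  proof -
    have "(\<integral>\<^sup>+\<omega>. ennreal (exp_functional X t \<omega> powr \<beta>) \<partial>M) \<le>
        (\<integral>\<^sup>+\<omega>. 1 + ennreal (exp_functional X t \<omega> powr 1) \<partial>M)"
    proof (rule nn_integral_mono)
      fix \<omega>
      let ?I = "exp_functional X t \<omega>"
      have "?I \<ge> 0"
        unfolding exp_functional_def set_lebesgue_integral_def
        by (intro Bochner_Integration.integral_nonneg) simp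
      \<comment> \<open>Below 1 the power is at most 1; above 1 it increases with the
        exponent.\<close>
      then have "?I powr \<beta> \<le> 1 + ?I powr 1"
        using \<beta> powr_le1[of \<beta> ?I] powr_mono[of \<beta> 1 ?I] powr_ge_zero[of ?I 1]
        by (cases "?I \<le> 1") (auto simp del: powr_ge_zero)
      then have "ennreal (?I powr \<beta>) \<le> ennreal (1 + ?I powr 1)" by (rule ennreal_leI)
      then show "ennreal (?I powr \<beta>) \<le> 1 + ennreal (?I powr 1)"
        by (subst (asm) ennreal_plus) auto
    qed
    also have "\<dots> < \<infinity>"
      using powr_moment[OF _ A1] borel_measurable_exp_functional[of X M t, OF X_rv X_cadlag]
      by (subst nn_integral_add) (auto simp: emeasure_space_1)
    finally show ?thesis .
  qed
  with iff powr_moment show ?thesis by blast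
qed

end
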